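(* Assume that at the value $t$ where $g$ achieves its minimum, $g''$ is bounded away from $0$ and $\infty$ and Lipschitz of order $\lambda>0$. Then for every $\delta>0$ there exists an estimator $\hat a$ such that, as $m\to\infty$, $$\frac{m^{2/5}}{(\log m)^{\delta}}\,(\hat a-\underline a)\rightsquigarrow N\bigl(0,(1-\underline a)^2\bigr).$$
   Context: Model: $P_1,P_2,\dots$ are i.i.d. with distribution function $G(t)=(1-a)t+aF(t)$ on $[0,1]$, where $a\in[0,1]$ and $F$ is a distribution function on $[0,1]$ with $F(t)\ge t$ for all $t$; $g=G'$ is the density of $G$. Let $U(t)=t$. Because $a$ need not be identifiable, define $$\zeta=\inf\{b\in[0,1]: F=(1-b)U+bH\text{ for some distribution function }H\text{ on }[0,1]\text{ in the class of admissible alternatives, i.e. with }H\ge U\},\qquad \underline a=a\,\zeta .$$ An estimator $\hat a=\hat a_m$ is a measurable function of $P_1,\dots,P_m$ not depending on the unknown $a$ and $F$. "Lipschitz of order $\lambda$" means Hölder continuous with exponent $\lambda$. The symbol $\rightsquigarrow$ denotes convergence in distribution. *)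

theory Defs
  imports "HOL-Probability.Probability"
begin

definition unit_distribution_function :: "(real \<Rightarrow> real) \<Rightarrow> bool" where
  "unit_distribution_function F \<longleftrightarrow>
     (\<exists>\<mu>. real_distribution \<mu> \<and> measure \<mu> {0..1} = 1 \<and> F = cdf \<mu>)"

definition admissible_alternative :: "(real \<Rightarrow> real) \<Rightarrow> bool" where
  "admissible_alternative F \<longleftrightarrow> unit_distribution_function F \<and> (\<forall>t\<in>{0..1}. t \<le> F t)"

(* (1 - b) U + b H; used only for arguments in [0,1], where U(t) = t. *)
definition uniform_mixture :: "real \<Rightarrow> (real \<Rightarrow> real) \<Rightarrow> real \<Rightarrow> real" where
  "uniform_mixture b H t = (1 - b) * t + b * H t"

definition zeta :: "(real \<Rightarrow> real) \<Rightarrow> real" where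
  "zeta F = Inf {b \<in> {0..1}. \<exists>H. admissible_alternative H \<and>
                    (\<forall>t\<in>{0..1}. F t = uniform_mixture b H t)}"

definition lower_a :: "real \<Rightarrow> (real \<Rightarrow> real) \<Rightarrow> real" where
  "lower_a a F = a * zeta F"

definition iid_mixture_model ::
  "'w measure \<Rightarrow> (nat \<Rightarrow> 'w \<Rightarrow> real) \<Rightarrow> real \<Rightarrow> (real \<Rightarrow> real) \<Rightarrow> bool" where
  "iid_mixture_model M P a F \<longleftrightarrow>
     prob_space M \<and> a \<in> {0..1} \<and> admissible_alternative F \<and>
     prob_space.indep_vars M (\<lambda>_. borel) P UNIV \<and>
     (\<forall>i. \<forall>t\<in>{0..1}. cdf (distr M borel (P i)) t = uniform_mixture a F t)"

(* The endpoint 0 is left out of the derivative condition so that the density may be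
   unbounded there, as for F t = sqrt t. *)
definition derivative_density :: "(real \<Rightarrow> real) \<Rightarrow> (real \<Rightarrow> real) \<Rightarrow> bool" where
  "derivative_density G g \<longleftrightarrow>
     (\<forall>t\<in>{0<..1}. (G has_real_derivative g t) (at t within {0..1})) \<and>
     (\<forall>t\<in>{0..1}. (g has_integral G t) {0..t})"

(* As g 0 is not constrained by derivative_density, minimisers are sought in (0,1]. This loses
   nothing: G t >= t forces g 0 >= 1 whenever g 0 is the derivative of G at 0, whereas a density
   on [0,1] with a strict minimiser has minimum below 1. The minimiser may be the endpoint 1
   (as for concave G), in which case derivatives there are one-sided. *)
definition unique_minimiser :: "(real \<Rightarrow> real) \<Rightarrow> real \<Rightarrow> bool" where
  "unique_minimiser g t \<longleftrightarrow> t \<in> {0<..1} \<and> (\<forall>s\<in>{0<..1}. s \<noteq> t \<longrightarrow> g t < g s)"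

(* On a relative neighbourhood of t, g'' exists, |g''| lies between positive constants, and
   g'' is Hoelder continuous with exponent l. At an interior minimiser g'' > 0 follows. *)
definition regular_second_derivative_at :: "real \<Rightarrow> (real \<Rightarrow> real) \<Rightarrow> real \<Rightarrow> bool" where
  "regular_second_derivative_at l g t \<longleftrightarrow>
     (\<exists>\<epsilon>>0. \<exists>c>0. \<exists>C L. \<exists>g1 g2 :: real \<Rightarrow> real.
        let N = {s \<in> {0<..1}. \<bar>s - t\<bar> < \<epsilon>} in
          (\<forall>s\<in>N. (g has_real_derivative g1 s) (at s within {0..1})) \<and>
          (\<forall>s\<in>N. (g1 has_real_derivative g2 s) (at s within {0..1})) \<and>
          (\<forall>s\<in>N. c \<le> \<bar>g2 s\<bar> \<and> \<bar>g2 s\<bar> \<le> C) \<and>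
          (\<forall>s\<in>N. \<forall>s'\<in>N. \<bar>g2 s - g2 s'\<bar> \<le> L * \<bar>s - s'\<bar> powr l))"

(* Parametrised by the variance v; normal_density is identically 0 for standard deviation 0,
   so the degenerate case, which occurs when lower_a a F = 1, is the point mass. *)
definition normal_law :: "real \<Rightarrow> real \<Rightarrow> real measure" where
  "normal_law \<mu> v =
     (if v = 0 then return borel \<mu> else density lborel (normal_density \<mu> (sqrt v)))"

(* T m is a function of a sample of size m, indexed by {..<m}. *)
definition estimator_sequence :: "(nat \<Rightarrow> (nat \<Rightarrow> real) \<Rightarrow> real) \<Rightarrow> bool" where
  "estimator_sequence T \<longleftrightarrow> (\<forall>m. T m \<in> borel_measurable (Pi\<^sub>M {..<m} (\<lambda>_. borel)))"

definition estimate ::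
  "(nat \<Rightarrow> (nat \<Rightarrow> real) \<Rightarrow> real) \<Rightarrow> (nat \<Rightarrow> 'w \<Rightarrow> real) \<Rightarrow> nat \<Rightarrow> 'w \<Rightarrow> real" where
  "estimate T P m \<omega> = T m (\<lambda>i\<in>{..<m}. P i \<omega>)"

end

theory Submission
  imports Defs "HOL-Real_Asymp.Real_Asymp"
begin

text \<open>
  The number \<open>lower_a a F\<close> is \<open>1 - g t\<close> (\<open>lower_a_eq\<close>): the uniform part that can be split off
  from \<open>F\<close> is limited only by the lowest slope of the distribution function \<open>G\<close>. Hence the
  minimum of the density \<open>g\<close> has to be estimated, at an unknown place.

  The limit law asks for less than it seems. Put \<open>r = m^(2/5) / (ln m)^\<delta>\<close>. As soon as there is
  an estimate \<open>u\<close> of \<open>g t\<close> with \<open>r * (u - g t) \<longrightarrow> 0\<close> in probability, Gaussian noise \<open>Z\<close> of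
  variance 1 can be added on purpose: for \<open>T = 1 - u + u * Z / r\<close>,
  \<open>r * (T - (1 - g t)) = g t * Z + (g t - u) * (r - Z)\<close>, and the last term is negligible if
  \<open>|Z| \<le> r\<close>. The noise comes from the sample itself: the signs of the differences within the
  pairs \<open>(P 0, P 1), (P 2, P 3), \<dots>\<close> are independent fair coin tosses whatever the law of the
  sample, which has no atoms, so that their standardised sum is asymptotically standard normal
  (\<open>sign_sum_weak_conv\<close>). Taking only about \<open>ln m\<close> pairs makes \<open>|Z| \<le> sqrt (ln m)\<close> hold surely.
  Levy's continuity theorem then gives the limit (\<open>weak_conv_m_perturbation\<close>).

  For \<open>u\<close> the unit interval is divided into \<open>n\<close> cells, \<open>n \<approx> m^(1/5)\<close>. The relative frequency of
  a cell, times \<open>n\<close>, has mean the average of \<open>g\<close> over the cell and standard deviation of order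
  \<open>n^(-2)\<close>. Averages of \<open>g\<close> are never below \<open>g t\<close>, and at an interior minimiser the cell of \<open>t\<close>
  has an average of at most \<open>g t + C / n\<^sup>2\<close>. Minimising over all cells would lose a fixed power
  of the logarithm to the fluctuations. Minimising over a set of cells whose size is a power of
  \<open>ln m\<close> loses less than any given power of it, because the fluctuations have exponential tails.
  Such a set, containing the cell of \<open>t\<close>, is found with one half of the sample, and the minimum
  over it is evaluated with the other half: \<open>[0,1]\<close> is divided into about \<open>ln m\<close> blocks, and in
  each block the lowest cell and its neighbours up to distance \<open>ln m\<close> are selected. The block of
  \<open>t\<close> eventually lies where \<open>g\<close> grows quadratically, so that the mean of a cell more than \<open>ln m\<close>
  cells away from \<open>t\<close> exceeds the minimum by a multiple of \<open>(ln m)\<^sup>2 / n\<^sup>2\<close>, while the noise in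
  this block is at most of order \<open>ln m / n\<^sup>2\<close> (\<open>prob_leader_far\<close>). The other blocks do no harm:
  wherever \<open>g\<close> comes close to its minimum without attaining it, all averages are still at least
  \<open>g t\<close> (\<open>prob_leader_near_low\<close>).

  If the minimiser is the endpoint \<open>1\<close>, the slope of \<open>g\<close> there may be nonzero, and averages have
  an error of order \<open>1 / n\<close>. A linear extrapolation from the last two cells removes it. If the
  minimiser lies elsewhere, the extrapolated value tends to \<open>g 1 > g t\<close>, so that it can always
  take part in the minimum.
\<close>

section \<open>The target as the minimum of a density\<close>

lemma unit_distribution_functionE:
  assumes "unit_distribution_function F"
  shows unit_distribution_function_mono: "\<And>x y. x \<le> y \<Longrightarrow> F x \<le> F y"
    and unit_distribution_function_right_continuous: "\<And>x. continuous (at_right x) F"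
    and unit_distribution_function_at_1: "F 1 = 1"
proof -
  obtain \<mu> where \<mu>: "real_distribution \<mu>" "measure \<mu> {0..1} = 1" "F = cdf \<mu>"
    using assms by (auto simp: unit_distribution_function_def)
  interpret real_distribution \<mu> by fact
  show "\<And>x y. x \<le> y \<Longrightarrow> F x \<le> F y"
    by (simp add: \<mu> cdf_nondecreasing)
  show "\<And>x. continuous (at_right x) F"
    by (simp add: \<mu> cdf_is_right_cont)
  have "measure \<mu> {0..1} \<le> cdf \<mu> 1"
    unfolding cdf_def by (rule finite_measure_mono) auto
  then show "F 1 = 1"
    using \<mu> cdf_bounded_prob[of 1] by simp
qed

text \<open>
  The measure is the one with distribution function \<open>H\<close>. It gives no mass to the negative reals
  because the left limit of \<open>H\<close> at \<open>0\<close> vanishes.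
\<close>

lemma unit_distribution_functionI:
  fixes H :: "real \<Rightarrow> real"
  assumes mono: "\<And>x y. x \<le> y \<Longrightarrow> H x \<le> H y"
    and right_cont: "\<And>x. continuous (at_right x) H"
    and below: "\<And>x. x < 0 \<Longrightarrow> H x = 0"
    and above: "\<And>x. x \<ge> 1 \<Longrightarrow> H x = 1"
  shows "unit_distribution_function H"
proof -
  have bot: "(H \<longlongrightarrow> 0) at_bot"
    using below by (intro tendsto_eventually) (auto simp: eventually_at_bot_dense)
  have top: "(H \<longlongrightarrow> 1) at_top"
    using above by (intro tendsto_eventually) (auto simp: eventually_at_top_linorder)
  interpret real_distribution "interval_measure H"
    by (rule real_distribution_interval_measure[OF mono right_cont bot top])
  have cdf: "cdf (interval_measure H) = H"
    by (rule cdf_interval_measure[OF mono right_cont bot])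
  have "(H \<longlongrightarrow> measure (interval_measure H) {..<0}) (at_left 0)"
    using cdf_at_left[of 0] by (simp add: cdf)
  moreover have "(H \<longlongrightarrow> 0) (at_left 0)"
    using below by (intro tendsto_eventually) (auto simp: eventually_at_filter)
  ultimately have "measure (interval_measure H) {..<0} = 0"
    by (intro tendsto_unique[of "at_left (0::real)"]) auto
  moreover have "measure (interval_measure H) {..1} = 1"
    using cdf above[of 1] by (metis cdf_def order_refl)
  moreover have "measure (interval_measure H) ({..1} - {..<0})
      = measure (interval_measure H) {..1} - measure (interval_measure H) {..<0}"
    by (rule finite_measure_Diff) auto
  moreover have "{..1} - {..<0} = {0..1::real}" by auto
  ultimately have "measure (interval_measure H) {0..1} = 1" by simp
  then show ?thesis
    unfolding unit_distribution_function_def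
    using cdf real_distribution_axioms by metis
qed

locale mixture_density =
  fixes a :: real and F g :: "real \<Rightarrow> real" and t :: real
  assumes a_01: "a \<in> {0..1}"
    and F_admissible: "admissible_alternative F"
    and density: "derivative_density (uniform_mixture a F) g"
    and minimiser: "unique_minimiser g t"
begin

abbreviation G :: "real \<Rightarrow> real" where "G \<equiv> uniform_mixture a F"

lemma F_distribution: "unit_distribution_function F"
  and F_ge: "s \<in> {0..1} \<Longrightarrow> s \<le> F s"
  using F_admissible by (auto simp: admissible_alternative_def)

lemmas F_mono = unit_distribution_function_mono[OF F_distribution]
  and F_right_continuous = unit_distribution_function_right_continuous[OF F_distribution]
  and F_1 = unit_distribution_function_at_1[OF F_distribution]

lemma t_01: "0 < t" "t \<le> 1"
  and g_min: "s \<in> {0<..1} \<Longrightarrow> g t \<le> g s"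
  and g_strict_min: "s \<in> {0<..1} \<Longrightarrow> s \<noteq> t \<Longrightarrow> g t < g s"
  using minimiser by (force simp: unique_minimiser_def)+

lemma G_derivative: "s \<in> {0<..1} \<Longrightarrow> (G has_real_derivative g s) (at s within {0..1})"
  using density by (simp add: derivative_density_def)

lemma G_derivative_interior: "0 < s \<Longrightarrow> s < 1 \<Longrightarrow> (G has_real_derivative g s) (at s)"
  using G_derivative[of s] at_within_Icc_at[of 0 s 1] by auto

text \<open>
  The integral of the density over a single point vanishes. So the law of the sample has no atom
  at \<open>0\<close>.
\<close>

lemma G_0: "G 0 = 0"
proof -
  have "(g has_integral G 0) {0..0}"
    using density unfolding derivative_density_def by (metis atLeastAtMost_iff order_refl zero_le_one)
  then show ?thesis
    using has_integral_refl(2)[of g 0] by (simp add: has_integral_unique)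
qed

lemma G_1: "G 1 = 1"
  by (simp add: uniform_mixture_def F_1)

text \<open>
  At the left endpoint the derivative condition says nothing, and continuity comes from the
  right continuity of distribution functions.
\<close>

lemma G_continuous: "continuous_on {0..1} G"
proof (clarsimp simp: continuous_on_eq_continuous_within)
  fix s :: real assume s: "0 \<le> s" "s \<le> 1"
  show "continuous (at s within {0..1}) G"
  proof (cases "s = 0")
    case True
    have "continuous (at_right 0) G"
      unfolding uniform_mixture_def
      by (intro continuous_intros F_right_continuous)
    then show ?thesis
      by (simp add: True at_within_Icc_at_right)
  next
    case False
    then show ?thesis
      using G_derivative[of s] s by (auto intro: DERIV_continuous)
  qed
qed

text \<open>
  Through this, pointwise bounds for \<open>g\<close> become bounds for its averages over cells, although \<open>g\<close>
  may be discontinuous.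
\<close>

lemma mean_value:
  assumes "0 \<le> x" "x < y" "y \<le> 1"
  obtains z where "x < z" "z < y" "G y - G x = (y - x) * g z"
proof -
  have "continuous_on {x..y} G"
    by (rule continuous_on_subset[OF G_continuous]) (use assms in auto)
  moreover have "(G has_real_derivative g z) (at z)" if "x < z" "z < y" for z
    using that assms by (intro G_derivative_interior) auto
  ultimately obtain l z where z: "x < z" "z < y" "(G has_real_derivative l) (at z)" "G y - G x = (y - x) * l"
    using MVT[of x y G] assms(2) by (metis real_differentiable_def)
  moreover have "l = g z"
    using z(1-3) assms by (intro DERIV_unique[OF z(3)] G_derivative_interior) auto
  ultimately show ?thesis using that by blast
qed

lemma increment_ge:
  assumes "0 \<le> x" "x \<le> y" "y \<le> 1"
  shows "g t * (y - x) \<le> G y - G x"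
proof (cases "x = y")
  case False
  then obtain z where "x < z" "z < y" "G y - G x = (y - x) * g z"
    using mean_value[of x y] assms by (metis less_eq_real_def)
  then show ?thesis
    using g_min[of z] assms by (simp add: mult.commute mult_left_mono)
qed simp

lemma mixture_increment_ge:
  assumes "x \<le> y" shows "(1 - a) * (y - x) \<le> G y - G x"
  using F_mono[OF assms] a_01 by (simp add: uniform_mixture_def algebra_simps mult_left_mono)

text \<open>
  Difference quotients of \<open>G\<close> at \<open>t\<close> are at least \<open>c\<close>, from one side or from both.
\<close>

lemma slope_bound:
  assumes "\<And>x y. 0 \<le> x \<Longrightarrow> x \<le> y \<Longrightarrow> y \<le> 1 \<Longrightarrow> c * (y - x) \<le> G y - G x"
  shows "c \<le> g t"
proof (rule tendsto_lowerbound)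
  show "((\<lambda>y. (G y - G t) / (y - t)) \<longlongrightarrow> g t) (at t within {0..1})"
    using G_derivative[of t] t_01 by (simp add: has_field_derivative_iff)
  show "at t within {0..1} \<noteq> bot"
    using t_01 by (cases "t = 1") (simp_all add: at_within_Icc_at_left at_within_Icc_at)
  have "c \<le> (G y - G t) / (y - t)" if "y \<in> {0..1}" "y \<noteq> t" for y
  proof (cases "y < t")
    case True
    then have "(G y - G t) / (y - t) = (G t - G y) / (t - y)"
      by (metis minus_diff_eq minus_divide_divide)
    then show ?thesis
      using assms[of y t] True that t_01 by (simp add: pos_le_divide_eq)
  next
    case False
    then show ?thesis
      using assms[of t y] that t_01 by (simp add: pos_le_divide_eq)
  qed
  then show "\<forall>\<^sub>F y in at t within {0..1}. c \<le> (G y - G t) / (y - t)"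
    by (auto simp: eventually_at_filter)
qed

lemma min_ge: "1 - a \<le> g t"
  by (rule slope_bound) (rule mixture_increment_ge)

lemma min_nonneg: "0 \<le> g t"
  using min_ge a_01 by simp

text \<open>
  A density that is at least \<open>1\<close> everywhere is constantly \<open>1\<close> and has no strict minimum.
\<close>

lemma min_less_1: "g t < 1"
proof (rule ccontr)
  assume "\<not> g t < 1"
  then have "1 \<le> g t" by simp
  have G_eq: "G y = y" if "y \<in> {0..1}" for y
  proof -
    have "y \<le> g t * y" "1 - y \<le> g t * (1 - y)"
      using \<open>1 \<le> g t\<close> that mult_right_mono[of 1 "g t" y] mult_right_mono[of 1 "g t" "1 - y"] by auto
    then show ?thesis
      using increment_ge[of 0 y] increment_ge[of y 1] that by (simp add: G_0 G_1)
  qed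
  have "((\<lambda>x. x) has_real_derivative 1) (at (t/2))" by simp
  then have "(G has_real_derivative 1) (at (t/2))"
    by (rule has_field_derivative_transform_within_open[of _ _ _ "{0<..<1}"]) (use t_01 G_eq in auto)
  then have "g (t/2) = 1"
    using t_01 by (intro DERIV_unique[OF G_derivative_interior]) auto
  moreover have "g t < g (t/2)"
    using g_strict_min[of "t/2"] t_01 by simp
  ultimately show False
    using \<open>1 \<le> g t\<close> by simp
qed

lemma a_pos: "0 < a"
  using min_ge min_less_1 a_01 by (cases "a = 0") auto

lemma F_0: "F 0 = 0"
  using G_0 a_pos by (simp add: uniform_mixture_def)

text \<open>
  Splitting off from \<open>F\<close> the uniform part of weight \<open>1 - (1 - g t) / a\<close> and rescaling leaves the
  distribution function \<open>H\<close> below, which increases because \<open>G\<close> has slope at least \<open>g t\<close>. A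
  heavier uniform part would force the slope of \<open>G\<close> at \<open>t\<close> to exceed \<open>g t\<close>.
\<close>

lemma zeta_eq: "zeta F = (1 - g t) / a"
proof -
  define b where "b = (1 - g t) / a"
  have b: "0 < b" "b \<le> 1" "a * b = 1 - g t"
    using min_less_1 min_ge a_pos by (auto simp: b_def)
  let ?B = "{b \<in> {0..1}. \<exists>H. admissible_alternative H \<and> (\<forall>s\<in>{0..1}. F s = uniform_mixture b H s)}"
  define H where "H s = (if s < 0 then 0 else if s \<ge> 1 then 1 else (F s - (1 - b) * s) / b)" for s
  have H_mid: "H s = (F s - (1 - b) * s) / b" if "s \<in> {0..1}" for s
    using that b F_1 by (auto simp: H_def field_simps)
  have H_mono_mid: "H x \<le> H y" if "0 \<le> x" "x \<le> y" "y \<le> 1" for x y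
  proof -
    have "(1 - a * b) * (y - x) \<le> G y - G x"
      using increment_ge[OF that] b by simp
    moreover have "(1 - a * b) * (y - x) = (1 - a) * y + a * ((1 - b) * y) - ((1 - a) * x + a * ((1 - b) * x))"
      by (simp add: algebra_simps)
    ultimately have "a * (F x - (1 - b) * x) \<le> a * (F y - (1 - b) * y)"
      by (simp add: uniform_mixture_def algebra_simps)
    then have "F x - (1 - b) * x \<le> F y - (1 - b) * y"
      using a_pos by simp
    then show ?thesis
      using that b by (simp add: H_mid divide_right_mono)
  qed
  have H_01: "H 0 = 0" "H 1 = 1"
    using b by (auto simp: H_mid F_0 F_1)
  have "unit_distribution_function H"
  proof (rule unit_distribution_functionI)
    show "H s = 0" if "s < 0" for s using that by (simp add: H_def)
    show "H s = 1" if "1 \<le> s" for s using that by (simp add: H_def)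
    have nonneg: "0 \<le> H s" and le_1: "H s \<le> 1" for s
      using H_mono_mid[of 0 s] H_mono_mid[of s 1] by (cases "s < 0"; cases "s \<ge> 1"; simp add: H_01; simp add: H_def)+
    show "H x \<le> H y" if "x \<le> y" for x y
      using H_mono_mid[OF _ that] nonneg[of y] le_1[of x] that
      by (cases "x < 0"; cases "y \<ge> 1") (auto simp: H_def)
    show "continuous (at_right x) H" for x
    proof -
      consider "x < 0" | "0 \<le> x" "x < 1" | "1 \<le> x" by linarith
      then show ?thesis
      proof cases
        case 1
        then have "\<forall>\<^sub>F s in at_right x. H s = 0"
          by (auto simp: eventually_at_right[of x 0] H_def)
        then show ?thesis
          using 1 by (simp add: continuous_within H_def tendsto_eventually)
      next
        case 2
        have "continuous (at_right x) (\<lambda>s. (F s - (1 - b) * s) / b)"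
          using b by (intro continuous_intros F_right_continuous) auto
        moreover have "\<forall>\<^sub>F s in at_right x. (F s - (1 - b) * s) / b = H s"
          unfolding eventually_at_right[OF \<open>x < 1\<close>] using 2 by (auto simp: H_def intro!: exI[of _ 1])
        ultimately show ?thesis
          using 2 tendsto_cong[of "\<lambda>s. (F s - (1 - b) * s) / b" H "at_right x"]
          by (simp add: continuous_within H_mid)
      next
        case 3
        then have "\<forall>\<^sub>F s in at_right x. H s = 1"
          by (auto simp: eventually_at_filter H_def)
        then show ?thesis
          using 3 by (simp add: continuous_within H_def tendsto_eventually)
      qed
    qed
  qed
  moreover have "s \<le> H s" if "s \<in> {0..1}" for s
    using F_ge[OF that] that b by (simp add: H_mid field_simps)
  moreover have "F s = uniform_mixture b H s" if "s \<in> {0..1}" for s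
    using that b by (simp add: H_mid uniform_mixture_def)
  ultimately have mem: "b \<in> ?B"
    using b unfolding admissible_alternative_def by auto
  have least: "b \<le> b'" if b'_mem: "b' \<in> ?B" for b'
  proof -
    obtain H' where b': "b' \<in> {0..1}" and H': "admissible_alternative H'"
      and F_H': "\<forall>s\<in>{0..1}. F s = uniform_mixture b' H' s"
      using b'_mem by blast
    have "unit_distribution_function H'"
      using H' by (simp add: admissible_alternative_def)
    note mono = unit_distribution_function_mono[OF this]
    have "1 - a * b' \<le> g t"
    proof (rule slope_bound)
      fix x y :: real assume xy: "0 \<le> x" "x \<le> y" "y \<le> 1"
      have "0 \<le> (a * b') * (H' y - H' x)"
        using mono[OF xy(2)] a_01 b' by simp
      also have "\<dots> = G y - G x - (1 - a * b') * (y - x)"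
        using xy by (simp add: uniform_mixture_def F_H' algebra_simps)
      finally show "(1 - a * b') * (y - x) \<le> G y - G x" by simp
    qed
    then show ?thesis
      using a_pos by (simp add: b_def divide_le_eq mult.commute)
  qed
  have "Inf ?B = b"
    by (rule cInf_eq_minimum[OF mem least])
  then show ?thesis
    by (simp add: zeta_def b_def)
qed

lemma lower_a_eq: "lower_a a F = 1 - g t"
  using a_pos by (simp add: lower_a_def zeta_eq)

end

section \<open>The density near its minimiser\<close>

lemma regular_second_derivative_atE:
  assumes "regular_second_derivative_at l g t"
  obtains \<epsilon> c g1 g2 C L where "\<epsilon> > 0" "c > 0"
    "\<forall>s\<in>{0<..1}. \<bar>s - t\<bar> < \<epsilon> \<longrightarrow> (g has_real_derivative g1 s) (at s within {0..1})"
    "\<forall>s\<in>{0<..1}. \<bar>s - t\<bar> < \<epsilon> \<longrightarrow> (g1 has_real_derivative g2 s) (at s within {0..1})"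
    "\<forall>s\<in>{0<..1}. \<bar>s - t\<bar> < \<epsilon> \<longrightarrow> c \<le> \<bar>g2 s\<bar> \<and> \<bar>g2 s\<bar> \<le> C"
    "\<forall>s\<in>{0<..1}. \<bar>s - t\<bar> < \<epsilon> \<longrightarrow> (\<forall>s'\<in>{0<..1}. \<bar>s' - t\<bar> < \<epsilon> \<longrightarrow>
        \<bar>g2 s - g2 s'\<bar> \<le> L * \<bar>s - s'\<bar> powr l)"
  using assms unfolding regular_second_derivative_at_def Let_def
proof (elim exE conjE)
  fix \<epsilon> c C L :: real and g1 g2 :: "real \<Rightarrow> real"
  let ?N = "{s \<in> {0<..1}. \<bar>s - t\<bar> < \<epsilon>}"
  assume "0 < \<epsilon>" "0 < c"
    "\<forall>s\<in>?N. (g has_real_derivative g1 s) (at s within {0..1})"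
    "\<forall>s\<in>?N. (g1 has_real_derivative g2 s) (at s within {0..1})"
    "\<forall>s\<in>?N. c \<le> \<bar>g2 s\<bar> \<and> \<bar>g2 s\<bar> \<le> C"
    "\<forall>s\<in>?N. \<forall>s'\<in>?N. \<bar>g2 s - g2 s'\<bar> \<le> L * \<bar>s - s'\<bar> powr l"
  then show thesis
    by (intro that[of \<epsilon> c g1 g2 C L]) blast+
qed

text \<open>
  Taylor's formula at the stationary point \<open>t\<close>. Since \<open>g2\<close> is continuous at \<open>t\<close> and bounded away
  from \<open>0\<close>, it has one sign near \<open>t\<close>, and a negative sign would make \<open>t\<close> a local maximiser.
\<close>

lemma quadratic_growth_at_minimiser:
  fixes g g1 g2 :: "real \<Rightarrow> real"
  assumes "\<epsilon> > 0" "0 < c"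
    and g1: "\<And>s. \<bar>s - t\<bar> < \<epsilon> \<Longrightarrow> (g has_real_derivative g1 s) (at s)"
    and g2: "\<And>s. \<bar>s - t\<bar> < \<epsilon> \<Longrightarrow> (g1 has_real_derivative g2 s) (at s)"
    and g2_bounds: "\<And>s. \<bar>s - t\<bar> < \<epsilon> \<Longrightarrow> c \<le> \<bar>g2 s\<bar> \<and> \<bar>g2 s\<bar> \<le> C"
    and g2_cont: "isCont g2 t"
    and strict: "\<And>s. \<bar>s - t\<bar> < \<epsilon> \<Longrightarrow> s \<noteq> t \<Longrightarrow> g t < g s"
  obtains \<eta> where "0 < \<eta>" "\<eta> \<le> \<epsilon>"
    "\<And>s. \<bar>s - t\<bar> < \<eta> \<Longrightarrow> g t + (c / 2) * (s - t)\<^sup>2 \<le> g s \<and> g s \<le> g t + (C / 2) * (s - t)\<^sup>2"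
proof -
  have stationary: "g1 t = 0"
  proof (rule DERIV_local_min[OF g1 assms(1)])
    show "\<forall>s. \<bar>t - s\<bar> < \<epsilon> \<longrightarrow> g t \<le> g s"
      using strict by (metis abs_minus_commute less_imp_le order_refl)
  qed (use assms(1) in simp)
  obtain d where d: "d > 0" "\<And>s. \<bar>s - t\<bar> < d \<Longrightarrow> \<bar>g2 s - g2 t\<bar> < c"
    using g2_cont assms(2) unfolding continuous_at_eps_delta dist_real_def by blast
  \<comment> \<open>Within the radius \<open>\<eta>\<close> the function \<open>g2\<close> keeps its sign, because \<open>|g2| \<ge> c\<close> while \<open>g2\<close> varies
  by less than \<open>c\<close>.\<close>
  define \<eta> where "\<eta> = min d \<epsilon>"
  have taylor: "\<exists>\<xi>. \<bar>\<xi> - t\<bar> < \<eta> \<and> g s = g t + g2 \<xi> / 2 * (s - t)\<^sup>2" if s: "\<bar>s - t\<bar> < \<eta>" "s \<noteq> t" for s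
  proof -
    define diff where "diff m = (if m = 0 then g else if m = 1 then g1 else g2)" for m :: nat
    define r where "r = \<bar>s - t\<bar>"
    have "\<forall>m u. m < 2 \<and> t - r \<le> u \<and> u \<le> t + r \<longrightarrow> DERIV (diff m) u :> diff (Suc m) u"
      using s g1 g2 by (auto simp: diff_def less_2_cases_iff r_def \<eta>_def)
    then have "\<exists>\<xi>. (if s < t then s < \<xi> \<and> \<xi> < t else t < \<xi> \<and> \<xi> < s) \<and>
        g s = (\<Sum>m<2. (diff m t / fact m) * (s - t) ^ m) + (diff 2 \<xi> / fact 2) * (s - t) ^ 2"
      using s by (intro Taylor[of 2 diff g "t - r" "t + r" t s]) (auto simp: diff_def r_def)
    then obtain \<xi> where \<xi>: "if s < t then s < \<xi> \<and> \<xi> < t else t < \<xi> \<and> \<xi> < s"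
      "g s = (\<Sum>m<2. (diff m t / fact m) * (s - t) ^ m) + (diff 2 \<xi> / fact 2) * (s - t) ^ 2"
      by blast
    have "\<bar>\<xi> - t\<bar> < \<eta>"
      using \<xi>(1) s by (auto split: if_splits)
    moreover have "g s = g t + g2 \<xi> / 2 * (s - t)\<^sup>2"
      using \<xi>(2) stationary by (simp add: diff_def numeral_2_eq_2 fact_numeral)
    ultimately show ?thesis by blast
  qed
  have pos: "c \<le> g2 \<xi>" if \<xi>: "\<bar>\<xi> - t\<bar> < \<eta>" for \<xi>
  proof (rule ccontr)
    assume "\<not> c \<le> g2 \<xi>"
    then have "g2 \<xi> \<le> - c"
      using g2_bounds[of \<xi>] \<xi> by (auto simp: \<eta>_def)
    then have "g2 t < 0"
      using d(2)[of \<xi>] \<xi> by (auto simp: \<eta>_def)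
    then have neg: "g2 u < 0" if "\<bar>u - t\<bar> < \<eta>" for u
      using d(2)[of u] g2_bounds[of u] g2_bounds[of t] assms that by (auto simp: \<eta>_def)
    define s where "s = t + \<eta> / 2"
    have s: "\<bar>s - t\<bar> < \<eta>" "s \<noteq> t"
      using d assms by (auto simp: s_def \<eta>_def)
    obtain u where "\<bar>u - t\<bar> < \<eta>" "g s = g t + g2 u / 2 * (s - t)\<^sup>2"
      using taylor[OF s] by blast
    moreover from this have "g2 u / 2 * (s - t)\<^sup>2 \<le> 0"
      using neg[of u] by (intro mult_nonpos_nonneg) auto
    ultimately show False
      using strict[of s] s by (auto simp: \<eta>_def)
  qed
  show thesis
  proof (rule that)
    show "0 < \<eta>" "\<eta> \<le> \<epsilon>" using d assms by (auto simp: \<eta>_def)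
    fix s assume s: "\<bar>s - t\<bar> < \<eta>"
    show "g t + (c / 2) * (s - t)\<^sup>2 \<le> g s \<and> g s \<le> g t + (C / 2) * (s - t)\<^sup>2"
    proof (cases "s = t")
      case False
      obtain u where u: "\<bar>u - t\<bar> < \<eta>" "g s = g t + g2 u / 2 * (s - t)\<^sup>2"
        using taylor[OF s False] by blast
      have "c \<le> g2 u" "g2 u \<le> C"
        using pos[OF u(1)] g2_bounds[of u] u(1) by (auto simp: \<eta>_def)
      then show ?thesis
        unfolding u(2) by (auto intro!: mult_right_mono)
    qed simp
  qed
qed

context mixture_density
begin

text \<open>
  Hoelder continuity enters here, as continuity of the second derivative at \<open>t\<close>.
\<close>

lemma interior_growth:
  assumes reg: "regular_second_derivative_at l g t" and "l > 0" and "t < 1"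
  obtains \<epsilon> c C where "0 < \<epsilon>" "0 < c" "0 \<le> C"
    "\<And>s. \<bar>s - t\<bar> < \<epsilon> \<Longrightarrow> s \<in> {0<..<1} \<and> g t + c * (s - t)\<^sup>2 \<le> g s \<and> g s \<le> g t + C * (s - t)\<^sup>2"
proof -
  obtain e c g1 g2 C L where e: "e > 0" "c > 0"
    and g1: "\<forall>s\<in>{0<..1}. \<bar>s - t\<bar> < e \<longrightarrow> (g has_real_derivative g1 s) (at s within {0..1})"
    and g2: "\<forall>s\<in>{0<..1}. \<bar>s - t\<bar> < e \<longrightarrow> (g1 has_real_derivative g2 s) (at s within {0..1})"
    and bounds: "\<forall>s\<in>{0<..1}. \<bar>s - t\<bar> < e \<longrightarrow> c \<le> \<bar>g2 s\<bar> \<and> \<bar>g2 s\<bar> \<le> C"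
    and holder: "\<forall>s\<in>{0<..1}. \<bar>s - t\<bar> < e \<longrightarrow> (\<forall>s'\<in>{0<..1}. \<bar>s' - t\<bar> < e \<longrightarrow>
        \<bar>g2 s - g2 s'\<bar> \<le> L * \<bar>s - s'\<bar> powr l)"
    by (rule regular_second_derivative_atE[OF reg]) (rule that)
  note g1 = g1[rule_format] and g2 = g2[rule_format] and bounds = bounds[rule_format]
    and holder = holder[rule_format]
  define \<epsilon> where "\<epsilon> = min e (min t (1 - t))"
  have \<epsilon>: "0 < \<epsilon>" using e t_01 \<open>t < 1\<close> by (auto simp: \<epsilon>_def)
  have near: "s \<in> {0<..<1} \<and> \<bar>s - t\<bar> < e" if "\<bar>s - t\<bar> < \<epsilon>" for s
    using that t_01 by (auto simp: \<epsilon>_def)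
  have cont: "isCont g2 t"
    unfolding isCont_def
  proof (rule Lim_null_comparison[THEN LIM_zero_cancel])
    show "\<forall>\<^sub>F s in at t. norm (g2 s - g2 t) \<le> L * \<bar>s - t\<bar> powr l"
      unfolding eventually_at using \<epsilon> t_01 holder[of _ t] near[of t] near
      by (intro exI[of _ \<epsilon>]) (force simp: dist_real_def)
    have "((\<lambda>s. \<bar>s - t\<bar>) \<longlongrightarrow> 0) (at t)"
      by (rule tendsto_eq_intros | simp)+
    from tendsto_powr'[OF this tendsto_const[of l]] \<open>l > 0\<close>
    have "((\<lambda>s. \<bar>s - t\<bar> powr l) \<longlongrightarrow> 0) (at t)"
      by (simp add: eventually_at_filter)
    from tendsto_mult_left[OF this, of L]
    show "((\<lambda>s. L * \<bar>s - t\<bar> powr l) \<longlongrightarrow> 0) (at t)" by simp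
  qed
  obtain \<eta> where \<eta>: "0 < \<eta>" "\<eta> \<le> \<epsilon>"
    "\<And>s. \<bar>s - t\<bar> < \<eta> \<Longrightarrow> g t + (c / 2) * (s - t)\<^sup>2 \<le> g s \<and> g s \<le> g t + (C / 2) * (s - t)\<^sup>2"
  proof (rule quadratic_growth_at_minimiser[of \<epsilon> c t g g1 g2 C])
    fix s assume s: "\<bar>s - t\<bar> < \<epsilon>"
    note n = near[OF s]
    show "(g has_real_derivative g1 s) (at s)" "(g1 has_real_derivative g2 s) (at s)"
      using g1[of s] g2[of s] n at_within_Icc_at[of 0 s 1] by auto
    show "c \<le> \<bar>g2 s\<bar> \<and> \<bar>g2 s\<bar> \<le> C" using bounds[of s] n by auto
    show "s \<noteq> t \<Longrightarrow> g t < g s" using g_strict_min[of s] n by auto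
  qed (use \<epsilon> e cont in auto)
  have "0 \<le> C / 2" using bounds[of t] t_01 e by auto
  then show thesis
    using \<eta> e near by (intro that[of \<eta> "c / 2" "C / 2"]) auto
qed

text \<open>
  The form in which the growth of \<open>g\<close> is applied to cells: the cell that contains \<open>t\<close> is light,
  and cells at distance \<open>d\<close> from \<open>t\<close> are heavier by a multiple of \<open>d\<^sup>2\<close>.
\<close>

lemma interior_increments:
  assumes reg: "regular_second_derivative_at l g t" and "l > 0" and "t < 1"
  obtains \<epsilon> c C where "0 < \<epsilon>" "0 < c" "0 \<le> C"
    "\<And>x y. 0 \<le> x \<Longrightarrow> x < y \<Longrightarrow> y \<le> 1 \<Longrightarrow> x \<le> t \<Longrightarrow> t \<le> y \<Longrightarrow> y - x < \<epsilon> \<Longrightarrow>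
       G y - G x \<le> (y - x) * (g t + C * (y - x)\<^sup>2)"
    "\<And>x y d. 0 \<le> x \<Longrightarrow> x < y \<Longrightarrow> y \<le> 1 \<Longrightarrow> \<bar>x - t\<bar> < \<epsilon> \<Longrightarrow> \<bar>y - t\<bar> < \<epsilon> \<Longrightarrow> 0 \<le> d \<Longrightarrow>
       t + d \<le> x \<or> y \<le> t - d \<Longrightarrow> (y - x) * (g t + c * d\<^sup>2) \<le> G y - G x"
proof -
  obtain \<epsilon> c C where eC: "0 < \<epsilon>" "0 < c" "0 \<le> C"
    and growth: "\<And>s. \<bar>s - t\<bar> < \<epsilon> \<Longrightarrow> s \<in> {0<..<1} \<and> g t + c * (s - t)\<^sup>2 \<le> g s \<and> g s \<le> g t + C * (s - t)\<^sup>2"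
    using interior_growth[OF assms] by blast
  show thesis
  proof (rule that[OF eC])
    fix x y assume xy: "0 \<le> x" "x < y" "y \<le> 1" "x \<le> t" "t \<le> y" "y - x < \<epsilon>"
    obtain z where z: "x < z" "z < y" "G y - G x = (y - x) * g z"
      using mean_value[of x y] xy by blast
    have "(z - t)\<^sup>2 \<le> (y - x)\<^sup>2"
      using z xy by (subst abs_le_square_iff[symmetric]) auto
    then have "C * (z - t)\<^sup>2 \<le> C * (y - x)\<^sup>2"
      using eC by (simp add: mult_left_mono)
    then have "g z \<le> g t + C * (y - x)\<^sup>2"
      using growth[of z] z xy by (smt (verit))
    then show "G y - G x \<le> (y - x) * (g t + C * (y - x)\<^sup>2)"
      using z xy by simp
  next
    fix x y d assume xy: "0 \<le> x" "x < y" "y \<le> 1" "\<bar>x - t\<bar> < \<epsilon>" "\<bar>y - t\<bar> < \<epsilon>" "0 \<le> d"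
      "t + d \<le> x \<or> y \<le> t - d"
    obtain z where z: "x < z" "z < y" "G y - G x = (y - x) * g z"
      using mean_value[of x y] xy by blast
    have "d\<^sup>2 \<le> (z - t)\<^sup>2"
      using z xy by (subst abs_le_square_iff[symmetric]) auto
    then have "c * d\<^sup>2 \<le> c * (z - t)\<^sup>2"
      using eC by (simp add: mult_left_mono)
    then have "g t + c * d\<^sup>2 \<le> g z"
      using growth[of z] z xy by auto
    then show "(y - x) * (g t + c * d\<^sup>2) \<le> G y - G x"
      using z xy by simp
  qed
qed

text \<open>
  If \<open>A\<close> is the average of \<open>g\<close> over \<open>[1 - h, 1]\<close> and \<open>B\<close> its average over \<open>[1 - 2 * h, 1]\<close>, this
  is \<open>2 * A - B\<close>, written with the increments over two disjoint cells.
\<close>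

definition extrapolation :: "real \<Rightarrow> real" where
  "extrapolation h = (3/2 * (G 1 - G (1 - h)) - 1/2 * (G (1 - h) - G (1 - 2 * h))) / h"

text \<open>
  Only the differentiability of \<open>G\<close> at \<open>1\<close> enters, as \<open>g\<close> may be discontinuous there. The second
  quotient is a combination of two difference quotients at \<open>1\<close>.
\<close>

lemma last_slopes_tendsto:
  shows "((\<lambda>h. (G 1 - G (1 - h)) / h) \<longlongrightarrow> g 1) (at_right 0)"
    and "((\<lambda>h. (G (1 - h) - G (1 - 2 * h)) / h) \<longlongrightarrow> g 1) (at_right 0)"
proof -
  have lim: "((\<lambda>y. (G y - G 1) / (y - 1)) \<longlongrightarrow> g 1) (at_left 1)"
    using G_derivative[of 1] by (simp add: has_field_derivative_iff at_within_Icc_at_left)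
  have flt: "filterlim (\<lambda>h. 1 - k * h) (at_left 1) (at_right (0::real))" if "k > 0" for k :: real
  proof -
    have "((\<lambda>h. 1 - k * h) \<longlongrightarrow> 1) (at_right 0)"
      by (rule tendsto_eq_intros | simp)+
    moreover have "\<forall>\<^sub>F h in at_right 0. 1 - k * h \<in> {..<1} - {1}"
      using that by (auto simp: eventually_at_filter)
    ultimately show ?thesis
      by (auto simp: filterlim_at elim: eventually_mono)
  qed
  have slope: "((\<lambda>h. (G 1 - G (1 - k * h)) / (k * h)) \<longlongrightarrow> g 1) (at_right 0)" if "k > 0" for k :: real
  proof -
    have "(x - y) / ((1 - z) - 1) = (y - x) / z" for x y z :: real
      using minus_divide_divide[of "y - x" z] by (simp only: minus_diff_eq diff_diff_eq2) simp
    then show ?thesis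
      using filterlim_compose[OF lim flt[OF that]] by simp
  qed
  show "((\<lambda>h. (G 1 - G (1 - h)) / h) \<longlongrightarrow> g 1) (at_right 0)"
    using slope[of 1] by simp
  have "((\<lambda>h. 2 * ((G 1 - G (1 - 2 * h)) / (2 * h)) - (G 1 - G (1 - 1 * h)) / (1 * h))
      \<longlongrightarrow> 2 * g 1 - g 1) (at_right 0)"
    by (intro tendsto_intros slope) auto
  moreover have "\<forall>\<^sub>F h in at_right 0. 2 * ((G 1 - G (1 - 2 * h)) / (2 * h)) - (G 1 - G (1 - 1 * h)) / (1 * h)
      = (G (1 - h) - G (1 - 2 * h)) / h"
    by (auto simp: eventually_at_filter field_simps)
  ultimately show "((\<lambda>h. (G (1 - h) - G (1 - 2 * h)) / h) \<longlongrightarrow> g 1) (at_right 0)"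
    by (simp add: filterlim_cong)
qed

lemma extrapolation_tendsto: "(extrapolation \<longlongrightarrow> g 1) (at_right 0)"
proof -
  have "((\<lambda>h. 3/2 * ((G 1 - G (1 - h)) / h) - 1/2 * ((G (1 - h) - G (1 - 2 * h)) / h))
      \<longlongrightarrow> 3/2 * g 1 - 1/2 * g 1) (at_right 0)"
    by (intro tendsto_intros last_slopes_tendsto)
  moreover have "(\<lambda>h. 3/2 * ((G 1 - G (1 - h)) / h) - 1/2 * ((G (1 - h) - G (1 - 2 * h)) / h)) = extrapolation"
  proof
    fix h show "3/2 * ((G 1 - G (1 - h)) / h) - 1/2 * ((G (1 - h) - G (1 - 2 * h)) / h) = extrapolation h"
      by (cases "h = 0") (simp_all add: extrapolation_def field_simps)
  qed
  ultimately show ?thesis by simp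
qed

text \<open>
  A first-order expansion with quadratic error, where \<open>\<beta>\<close> is the one-sided derivative of \<open>g\<close> at
  \<open>1\<close>. Two applications of the mean value inequality prove it, since the second derivative is
  bounded.
\<close>

lemma boundary_expansion:
  assumes reg: "regular_second_derivative_at l g t" and t: "t = 1"
  obtains \<epsilon> C \<beta> where "0 < \<epsilon>" "\<epsilon> < 1" "0 \<le> C"
    "\<And>s. s \<in> {1 - \<epsilon><..1} \<Longrightarrow> \<bar>g s - (g 1 + \<beta> * (s - 1))\<bar> \<le> C * (s - 1)\<^sup>2"
proof -
  obtain e c g1 g2 C L where e: "e > 0" "c > 0"
    and g1: "\<forall>s\<in>{0<..1}. \<bar>s - t\<bar> < e \<longrightarrow> (g has_real_derivative g1 s) (at s within {0..1})"
    and g2: "\<forall>s\<in>{0<..1}. \<bar>s - t\<bar> < e \<longrightarrow> (g1 has_real_derivative g2 s) (at s within {0..1})"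
    and bounds: "\<forall>s\<in>{0<..1}. \<bar>s - t\<bar> < e \<longrightarrow> c \<le> \<bar>g2 s\<bar> \<and> \<bar>g2 s\<bar> \<le> C"
    and "\<forall>s\<in>{0<..1}. \<bar>s - t\<bar> < e \<longrightarrow> (\<forall>s'\<in>{0<..1}. \<bar>s' - t\<bar> < e \<longrightarrow>
        \<bar>g2 s - g2 s'\<bar> \<le> L * \<bar>s - s'\<bar> powr l)"
    by (rule regular_second_derivative_atE[OF reg]) (rule that)
  note g1 = g1[rule_format] and g2 = g2[rule_format] and bounds = bounds[rule_format]
  define \<epsilon> where "\<epsilon> = min e (1/2)"
  have "0 \<le> C" using bounds[of 1] t e by auto
  have near: "u \<in> {0<..1} \<and> \<bar>u - t\<bar> < e" if "u \<in> {s..1}" "s \<in> {1 - \<epsilon><..1}" for s u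
    using that t by (auto simp: \<epsilon>_def min_def split: if_splits)
  have "\<bar>g s - (g 1 + g1 1 * (s - 1))\<bar> \<le> C * (s - 1)\<^sup>2" if s: "s \<in> {1 - \<epsilon><..1}" for s
  proof -
    have sub: "{s..1} \<subseteq> {0..1}" using near[OF _ s] by force
    have "\<bar>g1 u - g1 1\<bar> \<le> C * (1 - s)" if u: "u \<in> {s..1}" for u
    proof -
      have "norm (g1 u - g1 1) \<le> C * norm (u - 1)"
      proof (rule field_differentiable_bound[of "{s..1}" g1 g2])
        fix v assume v: "v \<in> {s..1}"
        show "(g1 has_real_derivative g2 v) (at v within {s..1})"
          using g2 near[OF v s] sub by (blast intro: DERIV_subset)
        show "norm (g2 v) \<le> C"
          using bounds near[OF v s] by auto
      qed (use u in auto)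
      also have "\<dots> \<le> C * (1 - s)"
        using u \<open>0 \<le> C\<close> by (intro mult_left_mono) auto
      finally show ?thesis by simp
    qed
    then have "norm ((g s - g1 1 * s) - (g 1 - g1 1 * 1)) \<le> C * (1 - s) * norm (s - 1)"
    proof (intro field_differentiable_bound[of "{s..1}" "\<lambda>u. g u - g1 1 * u" "\<lambda>u. g1 u - g1 1"])
      fix v assume v: "v \<in> {s..1}"
      have "(g has_real_derivative g1 v) (at v within {s..1})"
        using g1 near[OF v s] sub by (blast intro: DERIV_subset)
      then show "((\<lambda>u. g u - g1 1 * u) has_real_derivative g1 v - g1 1) (at v within {s..1})"
        by (auto intro!: derivative_eq_intros)
    qed (use s near[OF _ s] in auto)
    then show ?thesis
      using s by (simp add: algebra_simps power2_eq_square)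
  qed
  then show thesis
    using e \<open>0 \<le> C\<close> by (intro that[of \<epsilon> C "g1 1"]) (auto simp: \<epsilon>_def)
qed

text \<open>
  The weights \<open>3/2\<close> and \<open>-1/2\<close> cancel the linear term of the expansion: the averages of \<open>s - 1\<close>
  over the last two cells are \<open>-h/2\<close> and \<open>-3*h/2\<close>.
\<close>

lemma extrapolation_error:
  assumes reg: "regular_second_derivative_at l g t" and t: "t = 1"
  obtains \<epsilon> C where "0 < \<epsilon>" "\<And>h. 0 < h \<Longrightarrow> h < \<epsilon> \<Longrightarrow> \<bar>extrapolation h - g t\<bar> \<le> C * h\<^sup>2"
proof -
  obtain \<epsilon> C \<beta> where eC: "0 < \<epsilon>" "\<epsilon> < 1" "0 \<le> C"
    and g: "\<And>s. s \<in> {1 - \<epsilon><..1} \<Longrightarrow> \<bar>g s - (g 1 + \<beta> * (s - 1))\<bar> \<le> C * (s - 1)\<^sup>2"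
    using boundary_expansion[OF assms] by blast
  define Q where "Q = (\<lambda>s. g 1 * s + \<beta> * (s - 1)\<^sup>2 / 2)"
  have inc: "\<bar>(G y - G x) - (Q y - Q x)\<bar> \<le> (y - x) * (C * (1 - x)\<^sup>2)"
    if xy: "1 - \<epsilon> < x" "x < y" "y \<le> 1" for x y
  proof -
    let ?D = "\<lambda>s. G s - Q s"
    have der: "(?D has_real_derivative g z - (g 1 + \<beta> * (z - 1))) (at z)" if "x < z" "z < y" for z
    proof (rule DERIV_diff)
      show "(G has_real_derivative g z) (at z)"
        using that xy eC by (intro G_derivative_interior) auto
      show "(Q has_real_derivative g 1 + \<beta> * (z - 1)) (at z)"
        unfolding Q_def by (auto intro!: derivative_eq_intros)
    qed
    have "continuous_on {x..y} ?D"
      unfolding Q_def using xy eC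
      by (intro continuous_intros continuous_on_subset[OF G_continuous]) auto
    then obtain z where z: "x < z" "z < y"
        "?D y - ?D x = (g z - (g 1 + \<beta> * (z - 1))) * (y - x)"
      using mvt[OF xy(2), of ?D "\<lambda>z. (*) (g z - (g 1 + \<beta> * (z - 1)))"] der
      unfolding has_field_derivative_def by blast
    define k where "k = g z - (g 1 + \<beta> * (z - 1))"
    have "C * (z - 1)\<^sup>2 \<le> C * (1 - x)\<^sup>2"
      using eC z xy by (intro mult_left_mono abs_le_square_iff[THEN iffD1]) auto
    then have "\<bar>k\<bar> \<le> C * (1 - x)\<^sup>2"
      using g[of z] z xy unfolding k_def by (smt (verit) greaterThanAtMost_iff)
    moreover have "(G y - G x) - (Q y - Q x) = (y - x) * k"
      using z(3) by (simp add: k_def mult.commute)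
    ultimately show ?thesis
      using xy by (simp add: abs_mult mult_left_mono)
  qed
  show thesis
  proof (rule that[of "\<epsilon> / 2" "7/2 * C"])
    show "0 < \<epsilon> / 2" using eC by simp
    fix h :: real assume h: "0 < h" "h < \<epsilon> / 2"
    have 1: "\<bar>(G 1 - G (1 - h)) - (Q 1 - Q (1 - h))\<bar> \<le> h * (C * h\<^sup>2)"
      using inc[of "1 - h" 1] h eC by simp
    have 2: "\<bar>(G (1 - h) - G (1 - 2 * h)) - (Q (1 - h) - Q (1 - 2 * h))\<bar> \<le> h * (4 * C * h\<^sup>2)"
      using inc[of "1 - 2 * h" "1 - h"] h eC by (simp add: power_mult_distrib)
    have "3/2 * (Q 1 - Q (1 - h)) - 1/2 * (Q (1 - h) - Q (1 - 2 * h)) = h * g 1"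
      by (simp add: Q_def field_simps power2_eq_square)
    then have "\<bar>h * extrapolation h - h * g 1\<bar> \<le> h * (7/2 * C * h\<^sup>2)"
    proof -
      define E where "E = h * (C * h\<^sup>2)"
      have "h * (4 * C * h\<^sup>2) = 4 * E" "h * (7/2 * C * h\<^sup>2) = 7/2 * E"
        by (simp_all add: E_def)
      moreover have "h * extrapolation h = 3/2 * (G 1 - G (1 - h)) - 1/2 * (G (1 - h) - G (1 - 2 * h))"
        using h by (simp add: extrapolation_def)
      ultimately show ?thesis
        using 1 2 \<open>_ = h * g 1\<close> unfolding E_def[symmetric] by argo
    qed
    moreover have "\<bar>h * extrapolation h - h * g 1\<bar> = h * \<bar>extrapolation h - g 1\<bar>"
      using h by (metis abs_mult abs_of_pos right_diff_distrib)
    ultimately have "h * \<bar>extrapolation h - g 1\<bar> \<le> h * (7/2 * C * h\<^sup>2)"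
      by simp
    then show "\<bar>extrapolation h - g t\<bar> \<le> 7/2 * C * h\<^sup>2"
      using h t by simp
  qed
qed

end

section \<open>Exponential tail bounds for histograms\<close>

lemma exp_le_quadratic:
  fixes s :: real
  assumes "-1 \<le> s" "s \<le> 1"
  shows "exp s \<le> 1 + s + s\<^sup>2"
proof (cases "0 \<le> s")
  case True
  then show ?thesis using exp_bound[of s] assms by simp
next
  case False
  define u where "u = - s"
  have u: "0 < u" "u \<le> 1" using False assms by (auto simp: u_def)
  have "1 \<le> (1 - u + u\<^sup>2) * (1 + u)"
    using u by (simp add: algebra_simps power2_eq_square)
  also have "\<dots> \<le> (1 - u + u\<^sup>2) * exp u"
    using u exp_ge_add_one_self[of u] by (intro mult_left_mono) auto
  finally have "exp (- u) \<le> 1 - u + u\<^sup>2"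
    by (simp add: exp_minus divide_simps)
  then show ?thesis by (simp add: u_def)
qed

context prob_space
begin

text \<open>
  Independence turns the expectation into a product; the value is the moment generating function
  of a binomial distribution.
\<close>

lemma expectation_exp_count:
  fixes X :: "'i \<Rightarrow> 'a \<Rightarrow> real" and s :: real
  assumes fin: "finite I" and indep: "indep_vars (\<lambda>_. borel) X I" and A: "A \<in> sets borel"
    and q: "\<And>i. i \<in> I \<Longrightarrow> prob {\<omega> \<in> space M. X i \<omega> \<in> A} = q"
  shows "integrable M (\<lambda>\<omega>. exp (s * (\<Sum>i\<in>I. indicator A (X i \<omega>))))"
    and "expectation (\<lambda>\<omega>. exp (s * (\<Sum>i\<in>I. indicator A (X i \<omega>)))) = (1 + q * (exp s - 1)) ^ card I"
proof -
  note A[measurable]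
  have rv[measurable]: "X i \<in> borel_measurable M" if "i \<in> I" for i
    using indep that by (auto simp: indep_vars_def)
  let ?Y = "\<lambda>i \<omega>. 1 + (exp s - 1) * indicator A (X i \<omega>) :: real"
  have indepY: "indep_vars (\<lambda>_. borel) ?Y I"
    by (rule indep_vars_compose2[OF indep, where Y = "\<lambda>_ x. 1 + (exp s - 1) * indicator A x"]) measurable
  have int: "integrable M (\<lambda>\<omega>. indicator A (X i \<omega>) :: real)" if "i \<in> I" for i
    using that by (intro integrable_const_bound[where B = 1]) (auto simp: indicator_def)
  have exp_eq: "exp (s * (\<Sum>i\<in>I. indicator A (X i \<omega>))) = (\<Prod>i\<in>I. ?Y i \<omega>)" for \<omega>
    unfolding sum_distrib_left exp_sum[OF fin] by (rule prod.cong) (auto simp: indicator_def)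
  have EY: "expectation (?Y i) = 1 + q * (exp s - 1)" if i: "i \<in> I" for i
  proof -
    have "expectation (\<lambda>\<omega>. indicator A (X i \<omega>)) = expectation (indicator {\<omega> \<in> space M. X i \<omega> \<in> A})"
      by (intro Bochner_Integration.integral_cong) (auto simp: indicator_def)
    also have "\<dots> = q"
      using q[OF i] i by simp
    finally show ?thesis
      using int[OF i] by (simp add: prob_space mult.commute)
  qed
  show "integrable M (\<lambda>\<omega>. exp (s * (\<Sum>i\<in>I. indicator A (X i \<omega>))))"
    unfolding exp_eq by (rule indep_vars_integrable[OF fin indepY]) (use int in auto)
  show "expectation (\<lambda>\<omega>. exp (s * (\<Sum>i\<in>I. indicator A (X i \<omega>)))) = (1 + q * (exp s - 1)) ^ card I"
    unfolding exp_eq by (subst indep_vars_lebesgue_integral[OF fin indepY]) (use int EY in auto)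
qed

text \<open>
  Chernoff's method for both tails at once: \<open>s > 0\<close> bounds the probability of a large count and
  \<open>s < 0\<close> that of a small one. The variance enters through \<open>q * s\<^sup>2\<close>, which is essential for
  cells of small probability.
\<close>

lemma count_tail:
  fixes X :: "'i \<Rightarrow> 'a \<Rightarrow> real" and q s x :: real
  assumes fin: "finite I" and indep: "indep_vars (\<lambda>_. borel) X I" and A: "A \<in> sets borel"
    and q: "\<And>i. i \<in> I \<Longrightarrow> prob {\<omega> \<in> space M. X i \<omega> \<in> A} = q" and q_01: "0 \<le> q" "q \<le> 1"
    and s: "-1 \<le> s" "s \<le> 1"
  shows "prob {\<omega> \<in> space M. s * x \<le> s * (\<Sum>i\<in>I. indicator A (X i \<omega>))}
    \<le> exp (card I * q * (s + s\<^sup>2) - s * x)"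
proof -
  note A[measurable]
  have rv[measurable]: "X i \<in> borel_measurable M" if "i \<in> I" for i
    using indep that by (auto simp: indep_vars_def)
  let ?S = "\<lambda>\<omega>. \<Sum>i\<in>I. indicator A (X i \<omega>) :: real"
  have bound: "exp s - 1 \<le> s + s\<^sup>2"
    using exp_le_quadratic[OF s] by simp
  have "prob {\<omega> \<in> space M. s * x \<le> s * ?S \<omega>} = prob {\<omega> \<in> space M. exp (s * ?S \<omega>) \<ge> exp (s * x)}"
    by simp
  also have "\<dots> \<le> (1 / exp (s * x)) * expectation (\<lambda>\<omega>. exp (s * ?S \<omega>))"
    using integral_Markov_inequality_measure[OF expectation_exp_count(1)[OF fin indep A q, of s], of "space M" "exp (s * x)"]
    by simp
  also have "\<dots> = exp (- s * x) * (1 + q * (exp s - 1)) ^ card I"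
    by (subst expectation_exp_count(2)[OF fin indep A q]) (simp_all add: exp_minus divide_inverse)
  also have "\<dots> \<le> exp (- s * x) * (exp (q * (s + s\<^sup>2))) ^ card I"
  proof (intro mult_left_mono power_mono)
    have "1 + q * (exp s - 1) \<le> 1 + q * (s + s\<^sup>2)"
      using bound q_01 by (simp add: mult_left_mono)
    also have "\<dots> \<le> exp (q * (s + s\<^sup>2))"
      by (rule exp_ge_add_one_self)
    finally show "1 + q * (exp s - 1) \<le> exp (q * (s + s\<^sup>2))" .
    have "q * (1 - exp s) \<le> q * 1"
      using q_01 by (intro mult_left_mono) auto
    then show "0 \<le> 1 + q * (exp s - 1)"
      using q_01 mult_nonneg_nonneg[OF q_01(1) exp_ge_zero[of s]] unfolding right_diff_distrib by linarith
  qed simp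
  also have "\<dots> = exp (card I * q * (s + s\<^sup>2) - s * x)"
    by (simp add: exp_of_nat_mult[symmetric] exp_add[symmetric] algebra_simps)
  finally show ?thesis .
qed

end

text \<open>
  Half-open, so that the probability of a cell is an increment of the distribution function.
\<close>

definition cell :: "nat \<Rightarrow> nat \<Rightarrow> real set" where
  "cell n j = {real j / real n <.. real (Suc j) / real n}"

definition histogram :: "nat set \<Rightarrow> nat \<Rightarrow> nat \<Rightarrow> (nat \<Rightarrow> real) \<Rightarrow> real" where
  "histogram I n j x = real n * (\<Sum>i\<in>I. indicator (cell n j) (x i)) / card I"

lemma histogram_cong: "(\<And>i. i \<in> I \<Longrightarrow> x i = y i) \<Longrightarrow> histogram I n j x = histogram I n j y"
  by (simp add: histogram_def cong: sum.cong)

lemma measurable_histogram: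
  assumes "I \<subseteq> J"
  shows "histogram I n j \<in> borel_measurable (Pi\<^sub>M J (\<lambda>_. borel))"
proof -
  have [measurable]: "(\<lambda>x. x i) \<in> borel_measurable (Pi\<^sub>M J (\<lambda>_. borel))" if "i \<in> I" for i
    using assms that by (intro measurable_component_singleton) auto
  have [measurable]: "cell n j \<in> sets borel" by (simp add: cell_def)
  show ?thesis
    unfolding histogram_def[abs_def] by measurable
qed

locale iid_sample = mixture_density a F g t + prob_space M
  for M :: "'w measure" and P :: "nat \<Rightarrow> 'w \<Rightarrow> real" and a F g t +
  assumes indep: "indep_vars (\<lambda>_. borel) P UNIV"
    and cdf_P: "\<And>i s. s \<in> {0..1} \<Longrightarrow> cdf (distr M borel (P i)) s = G s"
begin

lemma P_measurable [measurable]: "P i \<in> borel_measurable M"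
  using indep by (auto simp: indep_vars_def)

lemma prob_Ioc:
  assumes "0 \<le> x" "x \<le> y" "y \<le> 1"
  shows "prob {\<omega> \<in> space M. P i \<omega> \<in> {x<..y}} = G y - G x"
proof (cases "x = y")
  case False
  interpret D: real_distribution "distr M borel (P i)" by simp
  have "G y - G x = measure (distr M borel (P i)) {x<..y}"
    using D.cdf_diff_eq[of x y] False assms by (simp add: cdf_P)
  also have "\<dots> = prob {\<omega> \<in> space M. P i \<omega> \<in> {x<..y}}"
    by (subst measure_distr) (auto intro!: arg_cong[where f = prob])
  finally show ?thesis by simp
qed simp

definition cell_mass :: "nat \<Rightarrow> nat \<Rightarrow> real" where
  "cell_mass n j = G (real (Suc j) / real n) - G (real j / real n)"

lemma prob_cell:
  assumes "j < n" shows "prob {\<omega> \<in> space M. P i \<omega> \<in> cell n j} = cell_mass n j"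
  unfolding cell_def cell_mass_def using assms
  by (intro prob_Ioc) (auto simp: field_simps)

lemma cell_mass_nonneg: "j < n \<Longrightarrow> 0 \<le> cell_mass n j"
  using prob_cell[of j n 0] by (metis measure_nonneg)

lemma cell_mass_ge:
  assumes "j < n" shows "g t \<le> n * cell_mass n j"
proof -
  have "g t * (real (Suc j) / real n - real j / real n) \<le> cell_mass n j"
    unfolding cell_mass_def using assms by (intro increment_ge) (auto simp: field_simps)
  then show ?thesis using assms by (simp add: field_simps)
qed

abbreviation H :: "nat set \<Rightarrow> nat \<Rightarrow> nat \<Rightarrow> 'w \<Rightarrow> real" where
  "H I n j \<omega> \<equiv> histogram I n j (\<lambda>i. P i \<omega>)"

lemma measurable_H [measurable]: "H I n j \<in> borel_measurable M"
  unfolding histogram_def cell_def by measurable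

text \<open>
  The assumption on \<open>b\<close> is an upper bound for the mean if \<open>s > 0\<close> and a lower bound if
  \<open>-1 < s < 0\<close>.
\<close>

lemma histogram_tail:
  assumes I: "finite I" "card I > 0" and j: "j < n" and s: "-1 \<le> s" "s \<le> 1"
    and b: "n * cell_mass n j * (s + s\<^sup>2) \<le> b * (s + s\<^sup>2)"
  shows "prob {\<omega> \<in> space M. s * y \<le> s * H I n j \<omega>} \<le> exp (card I / n * (b * s\<^sup>2 + s * (b - y)))"
proof -
  let ?S = "\<lambda>\<omega>. \<Sum>i\<in>I. indicator (cell n j) (P i \<omega>) :: real"
  have pos: "0 < card I / n" using I j by simp
  have H_eq: "H I n j \<omega> * (card I / n) = ?S \<omega>" for \<omega>
    using I j by (simp add: histogram_def)
  have "s * y \<le> s * H I n j \<omega> \<longleftrightarrow> s * (y * (card I / n)) \<le> s * ?S \<omega>" for \<omega>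
    unfolding H_eq[symmetric] mult.assoc[symmetric] using pos by (simp only: mult_le_cancel_right_pos)
  then have "prob {\<omega> \<in> space M. s * y \<le> s * H I n j \<omega>}
      = prob {\<omega> \<in> space M. s * (y * (card I / n)) \<le> s * ?S \<omega>}"
    by simp
  also have "\<dots> \<le> exp (card I * cell_mass n j * (s + s\<^sup>2) - s * (y * (card I / n)))"
  proof (rule count_tail)
    show "indep_vars (\<lambda>_. borel) P I"
      using indep_vars_subset[OF indep] by simp
    show "prob {\<omega> \<in> space M. P i \<omega> \<in> cell n j} = cell_mass n j" for i
      by (rule prob_cell[OF j])
    show "cell_mass n j \<le> 1"
      using prob_cell[OF j, of 0] by (metis prob_le_1)
  qed (use I s j cell_mass_nonneg in \<open>auto simp: cell_def\<close>)
  also have "\<dots> \<le> exp (card I / n * (b * s\<^sup>2 + s * (b - y)))"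
  proof -
    have "card I / n * (n * cell_mass n j * (s + s\<^sup>2)) \<le> card I / n * (b * (s + s\<^sup>2))"
      using b pos by (intro mult_left_mono) auto
    moreover have "card I / n * (n * cell_mass n j * (s + s\<^sup>2)) = card I * cell_mass n j * (s + s\<^sup>2)"
      using j by simp
    ultimately show ?thesis
      by (simp add: algebra_simps)
  qed
  finally show ?thesis .
qed

text \<open>
  Deviations are measured in units of \<open>1 / n\<^sup>2\<close>, the order of the standard deviation when
  \<open>n ^ 5\<close> is comparable to the sample size. A lower bound \<open>b\<close> for the mean suffices, so that
  cells of large mass, which fluctuate more, are covered as well.
\<close>

lemma histogram_lower_tail:
  assumes I: "finite I" "card I > 0" and j: "j < n" and b: "b \<le> n * cell_mass n j"
  shows "prob {\<omega> \<in> space M. H I n j \<omega> \<le> b - v / (real n)\<^sup>2} \<le> exp (card I / real n ^ 5 * (b - v))"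
proof -
  define s :: real where "s = - (1 / (real n)\<^sup>2)"
  have n: "1 \<le> real n" using j by simp
  then have n2: "1 \<le> (real n)\<^sup>2" by (rule one_le_power)
  then have s: "-1 \<le> s" "s < 0" using n by (auto simp: s_def divide_le_eq)
  then have "s * (1 + s) \<le> 0" by (intro mult_nonpos_nonneg) auto
  then have "s + s\<^sup>2 \<le> 0" by (simp add: algebra_simps power2_eq_square)
  then have le: "n * cell_mass n j * (s + s\<^sup>2) \<le> b * (s + s\<^sup>2)"
    using b by (intro mult_right_mono_neg)
  have "prob {\<omega> \<in> space M. H I n j \<omega> \<le> b - v / (real n)\<^sup>2}
      = prob {\<omega> \<in> space M. s * (b - v / (real n)\<^sup>2) \<le> s * H I n j \<omega>}"
    using s by (simp only: mult_le_cancel_left_neg)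
  also have "\<dots> \<le> exp (card I / n * (b * s\<^sup>2 + s * (b - (b - v / (real n)\<^sup>2))))"
    using s by (intro histogram_tail I j le) auto
  also have "card I / n * (b * s\<^sup>2 + s * (b - (b - v / (real n)\<^sup>2))) = card I / real n ^ 5 * (b - v)"
    using j by (simp add: s_def field_simps eval_nat_numeral)
  finally show ?thesis .
qed

lemma histogram_upper_tail:
  assumes I: "finite I" "card I > 0" and j: "j < n" and b: "n * cell_mass n j \<le> b"
  shows "prob {\<omega> \<in> space M. b + v / (real n)\<^sup>2 \<le> H I n j \<omega>} \<le> exp (card I / real n ^ 5 * (b - v))"
proof -
  define s :: real where "s = 1 / (real n)\<^sup>2"
  have n: "1 \<le> real n" using j by simp
  then have n2: "1 \<le> (real n)\<^sup>2" by (rule one_le_power)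
  then have s: "0 < s" "s \<le> 1" using n by (auto simp: s_def divide_le_eq)
  then have le: "n * cell_mass n j * (s + s\<^sup>2) \<le> b * (s + s\<^sup>2)"
    using b by (intro mult_right_mono) auto
  have "prob {\<omega> \<in> space M. b + v / (real n)\<^sup>2 \<le> H I n j \<omega>}
      = prob {\<omega> \<in> space M. s * (b + v / (real n)\<^sup>2) \<le> s * H I n j \<omega>}"
    using s by (simp only: mult_le_cancel_left_pos)
  also have "\<dots> \<le> exp (card I / n * (b * s\<^sup>2 + s * (b - (b + v / (real n)\<^sup>2))))"
    using s by (intro histogram_tail I j le) auto
  also have "card I / n * (b * s\<^sup>2 + s * (b - (b + v / (real n)\<^sup>2))) = card I / real n ^ 5 * (b - v)"
    using j by (simp add: s_def field_simps eval_nat_numeral)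
  finally show ?thesis .
qed

end

section \<open>Minimising a histogram in two stages\<close>

text \<open>
  The blocks are the fibres of \<open>\<lambda>j. j * k div n\<close>. Ties are broken by the index, so that each
  block has exactly one leader.
\<close>

definition leads :: "nat set \<Rightarrow> nat \<Rightarrow> nat \<Rightarrow> nat \<Rightarrow> (nat \<Rightarrow> real) \<Rightarrow> bool" where
  "leads I n k j x \<longleftrightarrow> (\<forall>i<n. i * k div n = j * k div n \<longrightarrow>
     histogram I n j x < histogram I n i x \<or> histogram I n j x = histogram I n i x \<and> j \<le> i)"

definition endpoint_estimate :: "nat set \<Rightarrow> nat \<Rightarrow> (nat \<Rightarrow> real) \<Rightarrow> real" where
  "endpoint_estimate I n x = 3/2 * histogram I n (n - 1) x - 1/2 * histogram I n (n - 2) x"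

text \<open>
  \<open>I\<close> is the part of the sample that elects the leaders and \<open>J\<close> the part that evaluates the
  cells near them. The value \<open>1\<close> that other pairs contribute is harmless, since the minimum of a
  density on the unit interval is at most \<open>1\<close>.
\<close>

definition minimum_estimate :: "nat set \<Rightarrow> nat set \<Rightarrow> nat \<Rightarrow> nat \<Rightarrow> real \<Rightarrow> (nat \<Rightarrow> real) \<Rightarrow> real" where
  "minimum_estimate I J n k L x = Min (insert (endpoint_estimate J n x)
     ((\<lambda>(j, i). if leads I n k j x then histogram J n i x else 1) `
        {(j, i). j < n \<and> i < n \<and> \<bar>real i - real j\<bar> \<le> L}))"

lemma leads_cong: "(\<And>i. i \<in> I \<Longrightarrow> x i = y i) \<Longrightarrow> leads I n k j x = leads I n k j y"
  using histogram_cong[of I x y] by (simp add: leads_def)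

lemma minimum_estimate_cong:
  assumes "\<And>i. i \<in> I \<union> J \<Longrightarrow> x i = y i"
  shows "minimum_estimate I J n k L x = minimum_estimate I J n k L y"
proof -
  have "leads I n k j x = leads I n k j y" "histogram J n j x = histogram J n j y" for j
    using leads_cong[of I x y] histogram_cong[of J x y] assms by auto
  then show ?thesis
    unfolding minimum_estimate_def endpoint_estimate_def by (simp only:)
qed

lemma finite_pairs: "finite {(j, i). j < n \<and> i < n \<and> \<bar>real i - real j\<bar> \<le> L}"
  by (rule finite_subset[of _ "{..<n} \<times> {..<n}"]) auto

lemma pred_lexicographic_minimum:
  fixes f :: "nat \<Rightarrow> 'b \<Rightarrow> real"
  assumes [measurable]: "\<And>i. f i \<in> borel_measurable N"
  shows "Measurable.pred N (\<lambda>x. \<forall>i<n. i * k div n = j * k div n \<longrightarrow>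
      f j x < f i x \<or> f j x = f i x \<and> j \<le> i)"
  by measurable

lemma measurable_leads:
  assumes "I \<subseteq> K"
  shows "Measurable.pred (Pi\<^sub>M K (\<lambda>_. borel)) (leads I n k j)"
  unfolding leads_def by (rule pred_lexicographic_minimum[OF measurable_histogram[OF assms]])

lemma measurable_minimum_estimate:
  assumes "I \<subseteq> K" "J \<subseteq> K"
  shows "minimum_estimate I J n k L \<in> borel_measurable (Pi\<^sub>M K (\<lambda>_. borel))"
proof -
  note [measurable] = measurable_histogram[OF assms(2)] measurable_leads[OF assms(1)]
  define S where "S = {(j, i). j < n \<and> i < n \<and> \<bar>real i - real j\<bar> \<le> L}"
  define f where "f p x = (case p of None \<Rightarrow> endpoint_estimate J n x
    | Some (j, i) \<Rightarrow> if leads I n k j x then histogram J n i x else 1)" for p x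
  have "minimum_estimate I J n k L = (\<lambda>x. Min ((\<lambda>p. f p x) ` insert None (Some ` S)))"
    unfolding minimum_estimate_def S_def[symmetric] by (simp add: f_def image_image cong: image_cong)
  also have "\<dots> \<in> borel_measurable (Pi\<^sub>M K (\<lambda>_. borel))"
  proof (rule borel_measurable_Min)
    show "finite (insert None (Some ` S))" using finite_pairs[of n L] by (simp add: S_def)
    have "f None \<in> borel_measurable (Pi\<^sub>M K (\<lambda>_. borel))"
      unfolding f_def endpoint_estimate_def by simp
    moreover have "f (Some (j, i)) \<in> borel_measurable (Pi\<^sub>M K (\<lambda>_. borel))" for j i
      unfolding f_def by simp
    ultimately show "f p \<in> borel_measurable (Pi\<^sub>M K (\<lambda>_. borel))" for p
      by (cases p) auto
  qed
  finally show ?thesis .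
qed

lemma minimum_estimate_less_iff:
  "minimum_estimate I J n k L x < y \<longleftrightarrow> endpoint_estimate J n x < y \<or>
     (\<exists>j<n. \<exists>i<n. \<bar>real i - real j\<bar> \<le> L \<and> (if leads I n k j x then histogram J n i x else 1) < y)"
  unfolding minimum_estimate_def using finite_pairs[of n L] by (subst Min_less_iff) auto

lemma minimum_estimate_le_endpoint: "minimum_estimate I J n k L x \<le> endpoint_estimate J n x"
  unfolding minimum_estimate_def using finite_pairs[of n L] by (intro Min_le) auto

lemma minimum_estimate_le_histogram:
  assumes "j < n" "i < n" "\<bar>real i - real j\<bar> \<le> L" "leads I n k j x"
  shows "minimum_estimate I J n k L x \<le> histogram J n i x"
  unfolding minimum_estimate_def using finite_pairs[of n L] assms
  by (intro Min_le) (auto intro!: image_eqI[where x = "(j, i)"])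

lemma ex_leader:
  assumes "i < n"
  shows "\<exists>j<n. j * k div n = i * k div n \<and> leads I n k j x"
proof -
  let ?B = "{j. j < n \<and> j * k div n = i * k div n}"
  let ?h = "\<lambda>j. histogram I n j x"
  define m where "m = Min (?h ` ?B)"
  have "finite ?B" "?B \<noteq> {}" using assms by auto
  then have "m \<in> ?h ` ?B" unfolding m_def by (intro Min_in) auto
  then have ex: "\<exists>j. j \<in> ?B \<and> ?h j = m" by auto
  define j where "j = (LEAST j. j \<in> ?B \<and> ?h j = m)"
  have j: "j \<in> ?B" "?h j = m"
    using LeastI_ex[OF ex] by (auto simp: j_def)
  have "leads I n k j x"
    unfolding leads_def
  proof (intro allI impI)
    fix l assume l: "l < n" "l * k div n = j * k div n"
    then have "l \<in> ?B" using j by auto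
    then have "m \<le> ?h l"
      unfolding m_def using \<open>finite ?B\<close> by (intro Min_le) auto
    moreover have "j \<le> l" if "?h l = m"
      unfolding j_def using \<open>l \<in> ?B\<close> that by (intro Least_le) auto
    ultimately show "?h j < ?h l \<or> ?h j = ?h l \<and> j \<le> l"
      using j by (auto simp: less_le)
  qed
  then show ?thesis using j by auto
qed

lemma leader_unique:
  assumes "leads I n k i x" "leads I n k j x" "i < n" "j < n" "i * k div n = j * k div n"
  shows "i = j"
proof (rule antisym)
  show "i \<le> j"
    using assms(1)[unfolded leads_def, rule_format, of j] assms(2)[unfolded leads_def, rule_format, of i]
      assms(3-5) by auto
  show "j \<le> i"
    using assms(1)[unfolded leads_def, rule_format, of j] assms(2)[unfolded leads_def, rule_format, of i]
      assms(3-5) by auto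
qed

lemma card_near_le:
  assumes "0 \<le> L"
  shows "real (card {i. i < n \<and> \<bar>real i - real j\<bar> \<le> L}) \<le> 2 * L + 1"
proof -
  define l where "l = nat \<lfloor>L\<rfloor>"
  have "{i. i < n \<and> \<bar>real i - real j\<bar> \<le> L} \<subseteq> {j - l..j + l}"
  proof safe
    fix i assume "\<bar>real i - real j\<bar> \<le> L"
    then have "\<bar>int i - int j\<bar> \<le> \<lfloor>L\<rfloor>" by (simp add: le_floor_iff)
    then show "i \<in> {j - l..j + l}" by (auto simp: l_def)
  qed
  then have "card {i. i < n \<and> \<bar>real i - real j\<bar> \<le> L} \<le> card {j - l..j + l}"
    by (intro card_mono) auto
  also have "\<dots> \<le> 2 * l + 1" by simp
  finally have "real (card {i. i < n \<and> \<bar>real i - real j\<bar> \<le> L}) \<le> 2 * real l + 1"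
    by (metis (mono_tags) of_nat_1 of_nat_add of_nat_le_iff of_nat_mult of_nat_numeral)
  also have "real l \<le> L" using assms by (simp add: l_def)
  finally show ?thesis by simp
qed

context iid_sample
begin

abbreviation leader :: "nat set \<Rightarrow> nat \<Rightarrow> nat \<Rightarrow> nat \<Rightarrow> 'w \<Rightarrow> bool" where
  "leader I n k j \<omega> \<equiv> leads I n k j (\<lambda>i. P i \<omega>)"

lemma measurable_leader [measurable]: "Measurable.pred M (leader I n k j)"
  unfolding leads_def by measurable

text \<open>
  The two events depend on disjoint parts of the sample.
\<close>

lemma prob_leader_histogram:
  assumes "I \<inter> J = {}"
  shows "prob {\<omega> \<in> space M. leader I n k j \<omega> \<and> H J n i \<omega> \<le> y}
    = prob {\<omega> \<in> space M. leader I n k j \<omega>} * prob {\<omega> \<in> space M. H J n i \<omega> \<le> y}"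
proof -
  define A where "A = {x \<in> space (Pi\<^sub>M I (\<lambda>_. borel :: real measure)). leads I n k j x}"
  define B where "B = {x \<in> space (Pi\<^sub>M J (\<lambda>_. borel :: real measure)). histogram J n i x \<le> y}"
  let ?X = "\<lambda>\<omega>. restrict (\<lambda>i. P i \<omega>) I" and ?Y = "\<lambda>\<omega>. restrict (\<lambda>i. P i \<omega>) J"
  have AB: "A \<in> sets (Pi\<^sub>M I (\<lambda>_. borel))" "B \<in> sets (Pi\<^sub>M J (\<lambda>_. borel))"
    unfolding A_def B_def
    using measurable_leads[OF order_refl] measurable_histogram[OF order_refl] by measurable
  have "indep_var (Pi\<^sub>M I (\<lambda>_. borel)) ?X (Pi\<^sub>M J (\<lambda>_. borel)) ?Y"
    using indep_var_restrict[OF indep assms] by simp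
  from indep_varD[OF this AB]
  have "prob ((\<lambda>\<omega>. (?X \<omega>, ?Y \<omega>)) -` (A \<times> B) \<inter> space M)
      = prob (?X -` A \<inter> space M) * prob (?Y -` B \<inter> space M)" .
  moreover have lead: "leads I n k j (?X \<omega>) = leader I n k j \<omega>"
    and hist: "histogram J n i (?Y \<omega>) = H J n i \<omega>" for \<omega>
    by (auto intro!: leads_cong histogram_cong)
  have "(\<lambda>\<omega>. (?X \<omega>, ?Y \<omega>)) -` (A \<times> B) \<inter> space M
      = {\<omega> \<in> space M. leader I n k j \<omega> \<and> H J n i \<omega> \<le> y}"
    "?X -` A \<inter> space M = {\<omega> \<in> space M. leader I n k j \<omega>}"
    "?Y -` B \<inter> space M = {\<omega> \<in> space M. H J n i \<omega> \<le> y}"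
    by (auto simp: A_def B_def lead hist space_PiM)
  ultimately show ?thesis by simp
qed

text \<open>
  Two cells of one block never lead at the same time, so that each block contributes at most
  \<open>1\<close>.
\<close>

lemma sum_prob_leader:
  assumes "0 < k"
  shows "(\<Sum>j<n. prob {\<omega> \<in> space M. leader I n k j \<omega>}) \<le> k"
proof -
  have "(\<Sum>j<n. prob {\<omega> \<in> space M. leader I n k j \<omega>})
      = (\<Sum>b<k. \<Sum>j\<in>{j \<in> {..<n}. j * k div n = b}. prob {\<omega> \<in> space M. leader I n k j \<omega>})"
    using assms by (intro sum.group[symmetric]) (auto intro!: less_mult_imp_div_less simp: mult.commute)
  also have "\<dots> \<le> (\<Sum>b<k. 1)"
  proof (rule sum_mono)
    fix b
    have "(\<Sum>j\<in>{j \<in> {..<n}. j * k div n = b}. prob {\<omega> \<in> space M. leader I n k j \<omega>})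
        = prob (\<Union>j\<in>{j \<in> {..<n}. j * k div n = b}. {\<omega> \<in> space M. leader I n k j \<omega>})"
      by (rule finite_measure_finite_Union[symmetric])
         (auto simp: disjoint_family_on_def dest: leader_unique)
    also have "\<dots> \<le> 1" by simp
    finally show "(\<Sum>j\<in>{j \<in> {..<n}. j * k div n = b}. prob {\<omega> \<in> space M. leader I n k j \<omega>}) \<le> 1" .
  qed
  finally show ?thesis by simp
qed

text \<open>
  By independence of the two halves the random choice of cells costs only their expected number,
  which is at most \<open>k\<close> times \<open>2 * L + 1\<close>, and not the number \<open>n\<close> of all cells.
\<close>

lemma prob_leader_near_low:
  assumes J: "finite J" "card J > 0" and disj: "I \<inter> J = {}" and "0 < k" and L: "0 \<le> L"
  shows "prob {\<omega> \<in> space M. \<exists>j<n. \<exists>i<n. \<bar>real i - real j\<bar> \<le> L \<and> leader I n k j \<omega> \<and>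
            H J n i \<omega> \<le> g t - v / (real n)\<^sup>2}
    \<le> k * ((2 * L + 1) * exp (card J / real n ^ 5 * (g t - v)))"
proof -
  let ?E = "{\<omega> \<in> space M. \<exists>j<n. \<exists>i<n. \<bar>real i - real j\<bar> \<le> L \<and> leader I n k j \<omega> \<and>
            H J n i \<omega> \<le> g t - v / (real n)\<^sup>2}"
  let ?e = "exp (card J / real n ^ 5 * (g t - v))"
  let ?N = "\<lambda>j. {i. i < n \<and> \<bar>real i - real j\<bar> \<le> L}"
  let ?A = "\<lambda>j i. {\<omega> \<in> space M. leader I n k j \<omega> \<and> H J n i \<omega> \<le> g t - v / (real n)\<^sup>2}"
  let ?l = "\<lambda>j. prob {\<omega> \<in> space M. leader I n k j \<omega>}"
  have meas: "?A j i \<in> sets M" for j i by measurable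
  have "?E = (\<Union>j\<in>{..<n}. \<Union>i\<in>?N j. ?A j i)" by auto
  then have "prob ?E = prob (\<Union>j\<in>{..<n}. \<Union>i\<in>?N j. ?A j i)" by (rule arg_cong)
  also have "\<dots> \<le> (\<Sum>j<n. prob (\<Union>i\<in>?N j. ?A j i))"
    by (intro finite_measure_subadditive_finite image_subsetI sets.finite_UN meas) simp_all
  also have "\<dots> \<le> (\<Sum>j<n. ?l j * ((2 * L + 1) * ?e))"
  proof (rule sum_mono)
    fix j
    have "prob (\<Union>i\<in>?N j. ?A j i) \<le> (\<Sum>i\<in>?N j. prob (?A j i))"
      by (intro finite_measure_subadditive_finite image_subsetI meas) simp
    also have "\<dots> \<le> (\<Sum>i\<in>?N j. ?l j * ?e)"
    proof (rule sum_mono)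
      fix i assume i: "i \<in> ?N j"
      have "prob (?A j i) = ?l j * prob {\<omega> \<in> space M. H J n i \<omega> \<le> g t - v / (real n)\<^sup>2}"
        by (rule prob_leader_histogram[OF disj])
      also have "\<dots> \<le> ?l j * ?e"
        using i by (intro mult_left_mono[OF histogram_lower_tail[OF J _ cell_mass_ge]]) auto
      finally show "prob (?A j i) \<le> ?l j * ?e" .
    qed
    also have "\<dots> = card (?N j) * (?l j * ?e)" by simp
    also have "\<dots> \<le> (2 * L + 1) * (?l j * ?e)"
      by (intro mult_right_mono card_near_le L) auto
    finally show "prob (\<Union>i\<in>?N j. ?A j i) \<le> ?l j * ((2 * L + 1) * ?e)"
      by (simp add: mult_ac)
  qed
  also have "\<dots> = (\<Sum>j<n. ?l j) * ((2 * L + 1) * ?e)"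
    by (rule sum_distrib_right[symmetric])
  also have "\<dots> \<le> k * ((2 * L + 1) * ?e)"
    using L by (intro mult_right_mono sum_prob_leader \<open>0 < k\<close>) auto
  finally show ?thesis .
qed

text \<open>
  A cell that leads in the block of cell \<open>i\<close> is at most as high as cell \<open>i\<close>. If their means are
  separated by the gap, then cell \<open>i\<close> is too high or the leading cell too low.
\<close>

lemma prob_leader_far:
  assumes I: "finite I" "card I > 0" and i: "i < n"
    and mass: "n * cell_mass n i \<le> b"
    and far: "\<And>j. j < n \<Longrightarrow> j * k div n = i * k div n \<Longrightarrow> \<bar>real i - real j\<bar> > L \<Longrightarrow> b' \<le> n * cell_mass n j"
    and gap: "b + v / (real n)\<^sup>2 \<le> b' - v' / (real n)\<^sup>2"
  shows "prob {\<omega> \<in> space M. \<exists>j<n. j * k div n = i * k div n \<and> \<bar>real i - real j\<bar> > L \<and> leader I n k j \<omega>}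
    \<le> exp (card I / real n ^ 5 * (b - v)) + n * exp (card I / real n ^ 5 * (b' - v'))"
proof -
  let ?E = "{\<omega> \<in> space M. \<exists>j<n. j * k div n = i * k div n \<and> \<bar>real i - real j\<bar> > L \<and> leader I n k j \<omega>}"
  let ?e = "exp (card I / real n ^ 5 * (b - v))" and ?e' = "exp (card I / real n ^ 5 * (b' - v'))"
  let ?F = "{j. j < n \<and> j * k div n = i * k div n \<and> \<bar>real i - real j\<bar> > L}"
  let ?U = "{\<omega> \<in> space M. b + v / (real n)\<^sup>2 \<le> H I n i \<omega>}"
  let ?D = "\<lambda>j. {\<omega> \<in> space M. H I n j \<omega> \<le> b' - v' / (real n)\<^sup>2}"
  have fin: "finite ?F" by auto
  have "?E \<subseteq> ?U \<union> (\<Union>j\<in>?F. ?D j)"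
  proof
    fix \<omega> assume "\<omega> \<in> ?E"
    then obtain j where j: "\<omega> \<in> space M" "j \<in> ?F" "leader I n k j \<omega>" by auto
    then have "H I n j \<omega> \<le> H I n i \<omega>" using i by (auto simp: leads_def)
    then show "\<omega> \<in> ?U \<union> (\<Union>j\<in>?F. ?D j)"
      using j gap by (cases "b + v / (real n)\<^sup>2 \<le> H I n i \<omega>") auto
  qed
  then have "prob ?E \<le> prob (?U \<union> (\<Union>j\<in>?F. ?D j))"
    by (intro finite_measure_mono) (auto intro!: sets.finite_UN fin)
  also have "\<dots> \<le> prob ?U + prob (\<Union>j\<in>?F. ?D j)"
    by (intro measure_Un_le) (auto intro!: sets.finite_UN fin)
  also have "prob (\<Union>j\<in>?F. ?D j) \<le> (\<Sum>j\<in>?F. prob (?D j))"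
    by (rule finite_measure_subadditive_finite[OF fin]) auto
  also have "\<dots> \<le> (\<Sum>j\<in>?F. ?e')"
    using far by (intro sum_mono histogram_lower_tail I) auto
  also have "\<dots> \<le> n * ?e'"
  proof -
    have "card ?F \<le> card {..<n}" by (intro card_mono) auto
    then show ?thesis by (simp add: mult_right_mono)
  qed
  also have "prob ?U \<le> ?e"
    by (rule histogram_upper_tail[OF I i mass])
  finally show ?thesis by simp
qed

end

section \<open>Resolution of the histogram and noise\<close>

text \<open>
  With cells of width \<open>m^(-1/5)\<close> the squared width, which is the order of the bias, and the
  standard deviation of a histogram are both of order \<open>m^(-2/5)\<close>.
\<close>

definition resolution :: "nat \<Rightarrow> nat" where "resolution m = nat \<lceil>real m powr (1/5)\<rceil>"

text \<open>
  The number of blocks tends to infinity, so that the block of \<open>t\<close> shrinks to \<open>t\<close>, but slowly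
  enough to be negligible against the exponential tails.
\<close>

definition blocks :: "nat \<Rightarrow> nat" where "blocks m = nat \<lceil>ln (real m)\<rceil>"

lemma resolution_ge: "real m powr (1/5) \<le> real (resolution m)"
  unfolding resolution_def by (rule real_nat_ceiling_ge)

lemma resolution_le: "real (resolution m) \<le> real m powr (1/5) + 1"
  unfolding resolution_def by (simp add: of_nat_ceiling)

lemma blocks_ge: "ln (real m) \<le> real (blocks m)"
  unfolding blocks_def by (rule real_nat_ceiling_ge)

lemma blocks_le: "m \<ge> 1 \<Longrightarrow> real (blocks m) \<le> ln (real m) + 1"
  unfolding blocks_def by simp

lemma power_resolution_ge: "real m \<le> real (resolution m) ^ 5"
proof (cases "m = 0")
  case False
  then have "real m = (real m powr (1/5)) ^ 5"
    by (simp add: powr_power)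
  also have "\<dots> \<le> real (resolution m) ^ 5"
    using resolution_ge by (intro power_mono) auto
  finally show ?thesis .
qed simp

lemma square_resolution_ge: "real m powr (2/5) \<le> (real (resolution m))\<^sup>2"
proof -
  have "real m powr (2/5) = (real m powr (1/5))\<^sup>2"
    by (cases "m = 0") (auto simp: powr_power)
  also have "\<dots> \<le> (real (resolution m))\<^sup>2"
    using resolution_ge by (intro power_mono) auto
  finally show ?thesis .
qed

lemma filterlim_resolution: "filterlim (\<lambda>m. real (resolution m)) at_top sequentially"
proof (rule filterlim_at_top_mono)
  show "filterlim (\<lambda>m. real m powr (1/5)) at_top sequentially" by real_asymp
  show "\<forall>\<^sub>F m in sequentially. real m powr (1/5) \<le> real (resolution m)"
    using resolution_ge by simp
qed

lemma filterlim_ln_sequentially: "filterlim (\<lambda>m. ln (real m)) at_top sequentially"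
  by real_asymp

lemma eventually_sample_share:
  shows "\<forall>\<^sub>F m in sequentially. 1/4 \<le> card {..<m div 2} / real (resolution m) ^ 5 \<and>
      card {..<m div 2} / real (resolution m) ^ 5 \<le> 1"
    and "\<forall>\<^sub>F m in sequentially. 1/4 \<le> card {m div 2..<m} / real (resolution m) ^ 5 \<and>
      card {m div 2..<m} / real (resolution m) ^ 5 \<le> 1"
proof -
  have "\<forall>\<^sub>F m in sequentially. (real m powr (1/5) + 1) ^ 5 * (1/4) \<le> real m / 2 - 1/2"
    by real_asymp
  then have *: "\<forall>\<^sub>F m in sequentially. \<forall>N. real m / 2 - 1/2 \<le> real N \<longrightarrow> N \<le> m \<longrightarrow>
      1/4 \<le> N / real (resolution m) ^ 5 \<and> N / real (resolution m) ^ 5 \<le> 1"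
    using eventually_gt_at_top[of 0]
  proof eventually_elim
    case (elim m)
    define R where "R = real (resolution m) ^ 5"
    have "real m \<le> R"
      unfolding R_def by (rule power_resolution_ge)
    moreover from this have "0 < R"
      using elim(2) by linarith
    moreover have "R \<le> (real m powr (1/5) + 1) ^ 5"
      unfolding R_def by (intro power_mono resolution_le) auto
    ultimately show ?case
      unfolding R_def[symmetric] using elim(1) by (auto simp: le_divide_eq divide_le_eq)
  qed
  have half: "real m / 2 - 1/2 \<le> real (m div 2)" "real m / 2 - 1/2 \<le> real (m - m div 2)" for m
    by (auto simp: field_simps)
  show "\<forall>\<^sub>F m in sequentially. 1/4 \<le> card {..<m div 2} / real (resolution m) ^ 5 \<and>
      card {..<m div 2} / real (resolution m) ^ 5 \<le> 1"
    using * by eventually_elim (use half(1) in simp)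
  show "\<forall>\<^sub>F m in sequentially. 1/4 \<le> card {m div 2..<m} / real (resolution m) ^ 5 \<and>
      card {m div 2..<m} / real (resolution m) ^ 5 \<le> 1"
    using * by eventually_elim (use half(2) in \<open>metis card_atLeastLessThan diff_le_self\<close>)
qed

text \<open>
  Here \<open>\<theta>\<close> stands for \<open>card I / n ^ 5\<close>, the factor in the exponent of the tail bounds, which
  tends to \<open>1/2\<close> for either half of the sample.
\<close>

lemma share_exp_le:
  fixes \<theta> b v B :: real
  assumes "1/4 \<le> \<theta> \<and> \<theta> \<le> 1" "0 \<le> b" "b \<le> B" "0 \<le> v"
  shows "exp (\<theta> * (b - v)) \<le> exp (B - v / 4)"
proof -
  have "\<theta> * b \<le> 1 * B" "1/4 * v \<le> \<theta> * v"
    using assms mult_mono[of \<theta> 1 b B] mult_right_mono[of "1/4" \<theta> v] by auto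
  then show ?thesis by (simp add: algebra_simps)
qed

lemma exp_noise_tendsto_0:
  assumes "e > 0"
  shows "(\<lambda>m. exp (B - ln (real m) powr e / 4)) \<longlonglongrightarrow> 0"
    and "(\<lambda>m. (ln (real m) + 1) * ((2 * ln (real m) + 1) * exp (B - ln (real m) powr e / 4))) \<longlonglongrightarrow> 0"
proof -
  have "((\<lambda>x. exp (- (x powr e) / 4)) \<longlongrightarrow> 0) at_top"
    "((\<lambda>x. (x + 1) * ((2 * x + 1) * exp (- (x powr e) / 4))) \<longlongrightarrow> 0) at_top"
    using assms by real_asymp+
  note lim = this[THEN filterlim_compose, OF filterlim_ln_sequentially, THEN tendsto_mult_left, of "exp B",
      unfolded mult_zero_right]
  have split: "exp (B - y / 4) = exp B * exp (- y / 4)" for y :: real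
    by (simp flip: exp_add)
  have split': "x * (z * exp (B - y / 4)) = exp B * (x * (z * exp (- y / 4)))" for x y z :: real
    by (simp add: split)
  show "(\<lambda>m. exp (B - ln (real m) powr e / 4)) \<longlonglongrightarrow> 0"
    unfolding split by (rule lim(1))
  show "(\<lambda>m. (ln (real m) + 1) * ((2 * ln (real m) + 1) * exp (B - ln (real m) powr e / 4))) \<longlonglongrightarrow> 0"
    unfolding split' by (rule lim(2))
qed

lemma eventually_resolution_ge: "\<forall>\<^sub>F m in sequentially. K \<le> real (resolution m)"
  using filterlim_resolution by (simp add: filterlim_at_top)

lemma eventually_ln_ge: "\<forall>\<^sub>F m in sequentially. K \<le> ln (real m)"
  using filterlim_ln_sequentially by (simp add: filterlim_at_top)

lemma filterlim_inverse_resolution: "filterlim (\<lambda>m. 1 / real (resolution m)) (at_right 0) sequentially"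
  using filterlim_compose[OF filterlim_inverse_at_right_top filterlim_resolution]
  by (simp add: inverse_eq_divide)

lemma far_bound_tendsto_0: "(\<lambda>m. (real m powr (1/5) + 1) * exp (B - 2 * ln (real m))) \<longlonglongrightarrow> 0"
proof -
  have "(\<lambda>m. (real m powr (1/5) + 1) * exp (- 2 * ln (real m))) \<longlonglongrightarrow> 0"
    by real_asymp
  from tendsto_mult_left[OF this, of "exp B"]
  show ?thesis by (simp add: exp_diff exp_minus field_simps)
qed

lemma (in prob_space) prob_tendsto_0I:
  assumes "\<forall>\<^sub>F m in sequentially. prob (E m) \<le> f m" "f \<longlonglongrightarrow> 0"
  shows "(\<lambda>m. prob (E m)) \<longlonglongrightarrow> 0"
  using assms by (intro Lim_null_comparison[OF _ assms(2)]) auto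

context iid_sample
begin

lemma cell_mass_last:
  assumes "2 \<le> n"
  shows "cell_mass n (n - 1) = G 1 - G (1 - 1 / n)"
    and "cell_mass n (n - 2) = G (1 - 1 / n) - G (1 - 2 * (1 / n))"
proof -
  have "Suc (n - 1) = n" "Suc (n - 2) = n - 1"
    and "real (n - 1) / n = 1 - 1 / n" "real (n - 2) / n = 1 - 2 * (1 / n)" "real n / n = 1"
    using assms by (auto simp: of_nat_diff field_simps)
  then show "cell_mass n (n - 1) = G 1 - G (1 - 1 / n)"
    "cell_mass n (n - 2) = G (1 - 1 / n) - G (1 - 2 * (1 / n))"
    by (simp_all only: cell_mass_def)
qed

text \<open>
  At most a power of \<open>ln m\<close> many cells take part, each with an error probability
  \<open>exp (- (ln m)^e / 4)\<close> up to a constant.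
\<close>

lemma leader_near_low_negligible:
  assumes "e > 0"
  shows "(\<lambda>m. prob {\<omega> \<in> space M. \<exists>j<resolution m. \<exists>i<resolution m. \<bar>real i - real j\<bar> \<le> ln (real m) \<and>
      leader {..<m div 2} (resolution m) (blocks m) j \<omega> \<and>
      H {m div 2..<m} (resolution m) i \<omega> \<le> g t - ln (real m) powr e / (real (resolution m))\<^sup>2}) \<longlonglongrightarrow> 0"
proof (rule prob_tendsto_0I[OF _ exp_noise_tendsto_0(2)[OF assms, of 1]])
  show "\<forall>\<^sub>F m in sequentially. prob {\<omega> \<in> space M. \<exists>j<resolution m. \<exists>i<resolution m. \<bar>real i - real j\<bar> \<le> ln (real m) \<and>
      leader {..<m div 2} (resolution m) (blocks m) j \<omega> \<and>
      H {m div 2..<m} (resolution m) i \<omega> \<le> g t - ln (real m) powr e / (real (resolution m))\<^sup>2}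
    \<le> (ln (real m) + 1) * ((2 * ln (real m) + 1) * exp (1 - ln (real m) powr e / 4))"
    using eventually_sample_share(2) eventually_ge_at_top[of 3]
  proof eventually_elim
    case (elim m)
    let ?L = "ln (real m)"
    let ?E = "exp (card {m div 2..<m} / real (resolution m) ^ 5 * (g t - ?L powr e))"
    have L: "0 < ?L" using elim by simp
    have "0 < blocks m" using blocks_ge[of m] L by linarith
    then have "prob {\<omega> \<in> space M. \<exists>j<resolution m. \<exists>i<resolution m. \<bar>real i - real j\<bar> \<le> ln (real m) \<and>
      leader {..<m div 2} (resolution m) (blocks m) j \<omega> \<and>
      H {m div 2..<m} (resolution m) i \<omega> \<le> g t - ln (real m) powr e / (real (resolution m))\<^sup>2}
      \<le> real (blocks m) * ((2 * ?L + 1) * ?E)"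
      using L elim by (intro prob_leader_near_low) auto
    also have "\<dots> \<le> (?L + 1) * ((2 * ?L + 1) * exp (1 - ?L powr e / 4))"
      using L elim blocks_le[of m] min_nonneg min_less_1
      by (intro mult_mono share_exp_le) auto
    finally show ?case .
  qed
qed

text \<open>
  The means of the last two cells are bounded, as both tend to \<open>g 1\<close>.
\<close>

lemma endpoint_negligible:
  assumes "e > 0"
  shows "(\<lambda>m. prob {\<omega> \<in> space M. 2 * (ln (real m) powr e / (real (resolution m))\<^sup>2) \<le>
      \<bar>endpoint_estimate {m div 2..<m} (resolution m) (\<lambda>i. P i \<omega>) - extrapolation (1 / real (resolution m))\<bar>})
    \<longlonglongrightarrow> 0"
proof -
  define n where "n = resolution"
  define J where "J m = {m div 2..<m}" for m :: nat
  define v where "v m = ln (real m) powr e" for m :: nat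
  define B where "B = g 1 + 1"
  have lim: "(\<lambda>m. 4 * exp (B - v m / 4)) \<longlonglongrightarrow> 0"
    using tendsto_mult_right_zero[OF exp_noise_tendsto_0(1)[OF assms, of B], of 4] by (simp add: v_def)
  have mass: "\<forall>\<^sub>F m in sequentially. n m * cell_mass (n m) (n m - 1) \<le> B \<and> n m * cell_mass (n m) (n m - 2) \<le> B"
  proof -
    have "\<forall>\<^sub>F m in sequentially. (G 1 - G (1 - 1 / n m)) / (1 / n m) < B"
      unfolding n_def B_def
      by (rule order_tendstoD(2)[OF filterlim_compose[OF last_slopes_tendsto(1) filterlim_inverse_resolution]]) simp
    moreover have "\<forall>\<^sub>F m in sequentially. (G (1 - 1 / n m) - G (1 - 2 * (1 / n m))) / (1 / n m) < B"
      unfolding n_def B_def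
      by (rule order_tendstoD(2)[OF filterlim_compose[OF last_slopes_tendsto(2) filterlim_inverse_resolution]]) simp
    ultimately show ?thesis
      using eventually_resolution_ge[of 2]
    proof eventually_elim
      case (elim m)
      have n: "2 \<le> n m" using elim(3) by (simp add: n_def)
      then show ?case
        unfolding cell_mass_last[OF n] using elim(1,2) by (simp add: mult.commute)
    qed
  qed
  have "(\<lambda>m. prob {\<omega> \<in> space M. 2 * (v m / (real (n m))\<^sup>2) \<le>
      \<bar>endpoint_estimate (J m) (n m) (\<lambda>i. P i \<omega>) - extrapolation (1 / real (n m))\<bar>}) \<longlonglongrightarrow> 0"
  proof (rule prob_tendsto_0I[OF _ lim])
    show "\<forall>\<^sub>F m in sequentially. prob {\<omega> \<in> space M. 2 * (v m / (real (n m))\<^sup>2) \<le>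
        \<bar>endpoint_estimate (J m) (n m) (\<lambda>i. P i \<omega>) - extrapolation (1 / real (n m))\<bar>} \<le> 4 * exp (B - v m / 4)"
      using mass eventually_sample_share(2) eventually_ge_at_top[of 3] eventually_resolution_ge[of 2]
    proof eventually_elim
      case (elim m)
      have n: "2 \<le> n m" using elim(4) by (simp add: n_def)
      have J: "finite (J m)" "0 < card (J m)" using elim by (auto simp: J_def)
      define w where "w = v m / (real (n m))\<^sup>2"
      define q where "q j = n m * cell_mass (n m) j" for j
      let ?e = "exp (B - v m / 4)"
      let ?up = "\<lambda>j. {\<omega> \<in> space M. q j + w \<le> H (J m) (n m) j \<omega>}"
      let ?dn = "\<lambda>j. {\<omega> \<in> space M. H (J m) (n m) j \<omega> \<le> q j - w}"
      have tail: "prob (?up j) \<le> ?e" "prob (?dn j) \<le> ?e" if j: "j = n m - 1 \<or> j = n m - 2" for j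
      proof -
        have "j < n m" using j n by auto
        have share: "exp (card (J m) / real (n m) ^ 5 * (q j - v m)) \<le> ?e"
          using elim j cell_mass_nonneg[OF \<open>j < n m\<close>]
          by (intro share_exp_le) (auto simp: J_def n_def q_def v_def)
        show "prob (?up j) \<le> ?e" "prob (?dn j) \<le> ?e"
          using histogram_upper_tail[OF J \<open>j < n m\<close>, of "q j" "v m"]
            histogram_lower_tail[OF J \<open>j < n m\<close>, of "q j" "v m"] share
          unfolding w_def by (force simp: q_def intro: order_trans)+
      qed
      have extr: "extrapolation (1 / n m) = 3/2 * q (n m - 1) - 1/2 * q (n m - 2)"
        using n unfolding q_def cell_mass_last[OF n] extrapolation_def by (simp add: algebra_simps)
      have "{\<omega> \<in> space M. 2 * w \<le>
          \<bar>endpoint_estimate (J m) (n m) (\<lambda>i. P i \<omega>) - extrapolation (1 / real (n m))\<bar>}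
        \<subseteq> (?up (n m - 1) \<union> ?dn (n m - 1)) \<union> (?up (n m - 2) \<union> ?dn (n m - 2))"
        unfolding extr endpoint_estimate_def by (auto simp: abs_if split: if_splits)
      then have "prob {\<omega> \<in> space M. 2 * w \<le>
          \<bar>endpoint_estimate (J m) (n m) (\<lambda>i. P i \<omega>) - extrapolation (1 / real (n m))\<bar>}
        \<le> prob ((?up (n m - 1) \<union> ?dn (n m - 1)) \<union> (?up (n m - 2) \<union> ?dn (n m - 2)))"
        by (rule finite_measure_mono) measurable
      also have "\<dots> \<le> (prob (?up (n m - 1)) + prob (?dn (n m - 1))) + (prob (?up (n m - 2)) + prob (?dn (n m - 2)))"
        by (intro order_trans[OF measure_Un_le] add_mono measure_Un_le) measurable
      also have "\<dots> \<le> (?e + ?e) + (?e + ?e)"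
        using tail by (intro add_mono) auto
      finally show ?case by (simp add: w_def)
    qed
  qed
  then show ?thesis by (simp add: n_def J_def v_def)
qed

end

section \<open>Error of the estimated minimum\<close>

lemma same_block_near:
  fixes i j k n :: nat
  assumes "j * k div n = i * k div n" "0 < n"
  shows "\<bar>real j - real i\<bar> * real k \<le> real n"
proof -
  define q where "q = i * k div n"
  have "j * k = q * n + j * k mod n" "i * k = q * n + i * k mod n"
    using assms by (metis div_mult_mod_eq q_def)+
  moreover have "j * k mod n < n" "i * k mod n < n" using assms by auto
  ultimately have "\<bar>int (j * k) - int (i * k)\<bar> \<le> int n" by linarith
  then have "\<bar>real (j * k) - real (i * k)\<bar> \<le> real n" by linarith
  moreover have "real (j * k) - real (i * k) = (real j - real i) * real k"
    by (simp add: left_diff_distrib)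
  ultimately show ?thesis by (simp add: abs_mult)
qed

context iid_sample
begin

abbreviation min_estimate :: "nat \<Rightarrow> 'w \<Rightarrow> real" where
  "min_estimate m \<omega> \<equiv> minimum_estimate {..<m div 2} {m div 2..<m} (resolution m) (blocks m)
     (ln (real m)) (\<lambda>i. P i \<omega>)"

lemma measurable_min_estimate [measurable]: "min_estimate m \<in> borel_measurable M"
proof -
  let ?I = "{..<m}"
  have "(\<lambda>\<omega>. minimum_estimate {..<m div 2} {m div 2..<m} (resolution m) (blocks m) (ln (real m))
      (\<lambda>i\<in>?I. P i \<omega>)) \<in> borel_measurable M"
    by (rule measurable_compose[OF measurable_restrict measurable_minimum_estimate]) auto
  moreover have "minimum_estimate {..<m div 2} {m div 2..<m} (resolution m) (blocks m) (ln (real m))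
      (\<lambda>i\<in>?I. P i \<omega>) = min_estimate m \<omega>" for \<omega>
    by (rule minimum_estimate_cong) auto
  ultimately show ?thesis by simp
qed

text \<open>
  The index of the half-open cell that contains \<open>t\<close>.
\<close>

definition min_cell :: "nat \<Rightarrow> nat" where "min_cell n = nat \<lceil>t * n\<rceil> - 1"

lemma min_cell:
  assumes "0 < n"
  shows "min_cell n < n" "min_cell n / n < t" "t \<le> Suc (min_cell n) / n"
proof -
  have pos: "0 < t * n" using t_01 assms by simp
  have "t * real n \<le> 1 * real n" using t_01 by (intro mult_right_mono) auto
  define z where "z = \<lceil>t * real n\<rceil>"
  have "z \<le> int n" "0 < z"
    using \<open>t * real n \<le> 1 * real n\<close> pos by (auto simp: z_def ceiling_le_iff)
  then have "int (Suc (min_cell n)) = z" and "min_cell n < n"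
    by (auto simp: min_cell_def z_def[symmetric])
  then show "min_cell n < n" by simp
  have "real (Suc (min_cell n)) = \<lceil>t * n\<rceil>"
    using \<open>int (Suc (min_cell n)) = z\<close> unfolding z_def by (metis of_int_of_nat_eq)
  then have "t * n \<le> Suc (min_cell n)" "real (Suc (min_cell n)) < t * n + 1" by linarith+
  then show "min_cell n / n < t" "t \<le> Suc (min_cell n) / n"
    using assms by (auto simp: field_simps)
qed

lemma minimum_estimate_le_min_cell:
  assumes "0 < n"
    and "\<not> (\<exists>j<n. j * k div n = min_cell n * k div n \<and> \<bar>real (min_cell n) - real j\<bar> > L \<and> leads I n k j x)"
  shows "minimum_estimate I J n k L x \<le> histogram J n (min_cell n) x"
proof -
  obtain j where j: "j < n" "j * k div n = min_cell n * k div n" "leads I n k j x"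
    using ex_leader[OF min_cell(1)[OF assms(1)]] by blast
  then show ?thesis
    using assms min_cell(1)[OF assms(1)] by (intro minimum_estimate_le_histogram[of j]) (auto simp: not_less)
qed

text \<open>
  Outside two rare events, the leader of the block of \<open>t\<close> is within \<open>ln m\<close> cells of the cell of
  \<open>t\<close>, and the second half of the sample gives this cell a height of at most
  \<open>g t + (C + v) / n\<^sup>2\<close>.
\<close>

lemma interior_upper_negligible:
  assumes reg: "regular_second_derivative_at l g t" and "l > 0" and "t < 1" and "e > 0"
  obtains C where "0 \<le> C"
    "(\<lambda>m. prob {\<omega> \<in> space M. g t + (C + ln (real m) powr e) / (real (resolution m))\<^sup>2 < min_estimate m \<omega>}) \<longlonglongrightarrow> 0"
proof -
  obtain \<epsilon> c C where eC: "0 < \<epsilon>" "0 < c" "0 \<le> C"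
    and upper: "\<And>x y. 0 \<le> x \<Longrightarrow> x < y \<Longrightarrow> y \<le> 1 \<Longrightarrow> x \<le> t \<Longrightarrow> t \<le> y \<Longrightarrow> y - x < \<epsilon> \<Longrightarrow>
       G y - G x \<le> (y - x) * (g t + C * (y - x)\<^sup>2)"
    and lower: "\<And>x y d. 0 \<le> x \<Longrightarrow> x < y \<Longrightarrow> y \<le> 1 \<Longrightarrow> \<bar>x - t\<bar> < \<epsilon> \<Longrightarrow> \<bar>y - t\<bar> < \<epsilon> \<Longrightarrow> 0 \<le> d \<Longrightarrow>
       t + d \<le> x \<or> y \<le> t - d \<Longrightarrow> (y - x) * (g t + c * d\<^sup>2) \<le> G y - G x"
    using interior_increments[OF assms(1-3)] by blast
  define f where "f m = (exp (1 + C - ln (real m) powr 1 / 4)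
      + (real m powr (1/5) + 1) * exp (1 + c - 2 * ln (real m)))
      + exp (1 + C - ln (real m) powr e / 4)" for m :: nat
  have "f \<longlonglongrightarrow> (0 + 0) + 0"
    unfolding f_def by (intro tendsto_add exp_noise_tendsto_0(1) far_bound_tendsto_0 assms) simp
  then have "f \<longlonglongrightarrow> 0" by simp
  have gap: "\<forall>\<^sub>F m in sequentially. C + ln (real m) \<le> c * (ln (real m) - 1)\<^sup>2 - 8 * ln (real m)"
  proof -
    have "\<forall>\<^sub>F x in at_top. C + x \<le> c * (x - 1)\<^sup>2 - 8 * x"
      using eC by real_asymp
    then show ?thesis by (rule eventually_compose_filterlim) (rule filterlim_ln_sequentially)
  qed
  have fine: "\<forall>\<^sub>F m in sequentially. 1 / ln (real m) + 2 / real (resolution m) < \<epsilon>"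
  proof -
    have "(\<lambda>m. 1 / ln (real m) + 2 / real (resolution m)) \<longlonglongrightarrow> 0 + 0"
      by (intro tendsto_add tendsto_divide_0[OF tendsto_const]
          filterlim_at_top_imp_at_infinity filterlim_ln_sequentially filterlim_resolution)
    then show ?thesis using order_tendstoD(2)[of _ "0::real" sequentially \<epsilon>] eC by simp
  qed
  have small: "\<forall>\<^sub>F m in sequentially. ln (real m) \<le> real (resolution m)"
  proof -
    have "\<forall>\<^sub>F m in sequentially. ln (real m) \<le> real m powr (1/5)" by real_asymp
    then show ?thesis by eventually_elim (use resolution_ge order_trans in blast)
  qed
  have "(\<lambda>m. prob {\<omega> \<in> space M. g t + (C + ln (real m) powr e) / (real (resolution m))\<^sup>2 < min_estimate m \<omega>}) \<longlonglongrightarrow> 0"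
  proof (rule prob_tendsto_0I[OF _ \<open>f \<longlonglongrightarrow> 0\<close>])
    show "\<forall>\<^sub>F m in sequentially.
       prob {\<omega> \<in> space M. g t + (C + ln (real m) powr e) / (real (resolution m))\<^sup>2 < min_estimate m \<omega>} \<le> f m"
      using gap fine small eventually_sample_share eventually_ge_at_top[of 3] eventually_ln_ge[of 1]
    proof eventually_elim
      case (elim m)
      define n where "n = resolution m"
      define k where "k = blocks m"
      define L where "L = ln (real m)"
      define I where "I = {..<m div 2}"
      define J where "J = {m div 2..<m}"
      define i where "i = min_cell n"
      define d where "d = (L - 1) / n"
      have L: "1 \<le> L" "L \<le> n" using elim by (auto simp: L_def n_def)
      then have n: "0 < n" by linarith
      have k: "L \<le> k" using blocks_ge[of m] by (simp add: L_def k_def)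
      have I: "finite I" "0 < card I" and J: "finite J" "0 < card J"
        using elim by (auto simp: I_def J_def)
      have i: "i < n" "real i / n < t" "t \<le> Suc i / n"
        using min_cell[OF n] by (auto simp: i_def)
      have fine_m: "1 / L + 2 / n < \<epsilon>" using elim by (simp add: L_def n_def)
      have step: "real (Suc j) / n - real j / n = 1 / n" for j
        by (simp add: diff_divide_distrib[symmetric])
      have d: "0 \<le> d" "d\<^sup>2 = (L - 1)\<^sup>2 / (real n)\<^sup>2" "d \<le> 1"
        using L n by (auto simp: d_def power_divide divide_le_eq)
      have mass: "n * cell_mass n i \<le> g t + C / (real n)\<^sup>2"
      proof -
        have "cell_mass n i \<le> (1 / n) * (g t + C * (1 / n)\<^sup>2)"
          unfolding cell_mass_def step[symmetric, of i]
        proof (rule upper)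
          have "1 / n < \<epsilon>" using fine_m L n by (smt (verit) divide_nonneg_nonneg divide_right_mono of_nat_0_le_iff)
          then show "real (Suc i) / n - real i / n < \<epsilon>" by (simp only: step)
        qed (use i n in \<open>auto simp: field_simps\<close>)
        then show ?thesis using n by (simp add: field_simps power2_eq_square)
      qed
      have far: "g t + c * d\<^sup>2 \<le> n * cell_mass n j"
        if j: "j < n" "j * k div n = i * k div n" "\<bar>real i - real j\<bar> > L" for j
      proof -
        have "\<bar>real j - real i\<bar> * L \<le> \<bar>real j - real i\<bar> * k"
          using k by (intro mult_left_mono) auto
        also have "\<dots> \<le> n" by (rule same_block_near[OF j(2) n])
        finally have "\<bar>real j - real i\<bar> \<le> n / L" using L by (simp add: le_divide_eq)
        then have "\<bar>real j - real i\<bar> / n \<le> n / L / n" by (rule divide_right_mono) simp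
        then have near: "\<bar>real j / n - real i / n\<bar> \<le> 1 / L"
          using n by (simp add: diff_divide_distrib[symmetric])
        have "\<bar>real j / n - t\<bar> \<le> 1 / L + 1 / n" "\<bar>real (Suc j) / n - t\<bar> \<le> 1 / L + 2 / n"
          using near i step[of i] step[of j] n by (auto simp: abs_le_iff)
        then have close: "\<bar>real j / n - t\<bar> < \<epsilon>" "\<bar>real (Suc j) / n - t\<bar> < \<epsilon>"
          using fine_m n by (smt (verit) divide_right_mono of_nat_0_le_iff)+
        have side: "t + d \<le> real j / n \<or> real (Suc j) / n \<le> t - d"
        proof (cases "i < j")
          case True
          then have "(real i + 1 + (L - 1)) / n \<le> real j / n" using j by (intro divide_right_mono) auto
          then show ?thesis using i by (simp add: d_def add_divide_distrib diff_divide_distrib)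
        next
          case False
          then have "real (Suc j) / n \<le> (real i - (L - 1)) / n" using j by (intro divide_right_mono) auto
          then show ?thesis using i by (simp add: d_def diff_divide_distrib)
        qed
        have "(1 / n) * (g t + c * d\<^sup>2) \<le> cell_mass n j"
          unfolding cell_mass_def step[symmetric, of j]
          by (rule lower[OF _ _ _ close d(1) side]) (use j n in \<open>auto simp: field_simps\<close>)
        then show ?thesis using n by (simp add: field_simps)
      qed
      let ?F = "{\<omega> \<in> space M. \<exists>j<n. j * k div n = i * k div n \<and> \<bar>real i - real j\<bar> > L \<and> leader I n k j \<omega>}"
      let ?U = "{\<omega> \<in> space M. (g t + C / (real n)\<^sup>2) + L powr e / (real n)\<^sup>2 \<le> H J n i \<omega>}"
      \<comment> \<open>The allowance \<open>8 * L\<close> for the cells far from \<open>t\<close> turns into a probability of order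
      \<open>exp (- 2 * L)\<close> for each of them, which outweighs their number \<open>n \<le> exp (L / 5) + 1\<close>.\<close>
      have "prob ?F \<le> exp (card I / real n ^ 5 * ((g t + C / (real n)\<^sup>2) - L))
          + n * exp (card I / real n ^ 5 * ((g t + c * d\<^sup>2) - 8 * L))"
      proof (rule prob_leader_far[OF I i(1) mass])
        show "g t + c * d\<^sup>2 \<le> n * cell_mass n j"
          if "j < n" "j * k div n = i * k div n" "L < \<bar>real i - real j\<bar>" for j
          using that by (rule far)
        have "(C + L) / (real n)\<^sup>2 \<le> (c * (L - 1)\<^sup>2 - 8 * L) / (real n)\<^sup>2"
          using elim by (intro divide_right_mono) (auto simp: L_def)
        then show "(g t + C / (real n)\<^sup>2) + L / (real n)\<^sup>2 \<le> (g t + c * d\<^sup>2) - 8 * L / (real n)\<^sup>2"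
          by (simp add: d(2) add_divide_distrib diff_divide_distrib)
      qed
      also have "\<dots> \<le> exp (1 + C - L / 4) + (real m powr (1/5) + 1) * exp (1 + c - (8 * L) / 4)"
      proof (rule add_mono[OF share_exp_le mult_mono[OF _ share_exp_le]])
        have "1 \<le> (real n)\<^sup>2" using n by simp
        then have "C / (real n)\<^sup>2 \<le> C" using eC by (simp add: divide_le_eq mult_left_mono[of 1 _ C, simplified])
        then show "g t + C / (real n)\<^sup>2 \<le> 1 + C" using min_less_1 by simp
        have "c * d\<^sup>2 \<le> c * 1"
          using eC by (intro mult_left_mono power_le_one d(1) d(3)) auto
        then show "g t + c * d\<^sup>2 \<le> 1 + c" using min_less_1 by simp
      qed (use elim L eC min_nonneg resolution_le[of m] in \<open>auto simp: n_def I_def\<close>)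
      finally have F: "prob ?F \<le> exp (1 + C - L powr 1 / 4) + (real m powr (1/5) + 1) * exp (1 + c - 2 * L)"
        using L by simp
      have "prob ?U \<le> exp (card J / real n ^ 5 * ((g t + C / (real n)\<^sup>2) - L powr e))"
        by (rule histogram_upper_tail[OF J i(1) mass])
      also have "\<dots> \<le> exp (1 + C - L powr e / 4)"
      proof (rule share_exp_le)
        have "1 \<le> (real n)\<^sup>2" using n by simp
        then have "C / (real n)\<^sup>2 \<le> C" using eC by (simp add: divide_le_eq mult_left_mono[of 1 _ C, simplified])
        then show "g t + C / (real n)\<^sup>2 \<le> 1 + C" using min_less_1 by simp
      qed (use elim eC min_nonneg in \<open>auto simp: n_def J_def\<close>)
      finally have U: "prob ?U \<le> exp (1 + C - L powr e / 4)" .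
      have "{\<omega> \<in> space M. g t + (C + L powr e) / (real n)\<^sup>2 < min_estimate m \<omega>} \<subseteq> ?F \<union> ?U"
      proof
        fix \<omega> assume \<omega>: "\<omega> \<in> {\<omega> \<in> space M. g t + (C + L powr e) / (real n)\<^sup>2 < min_estimate m \<omega>}"
        show "\<omega> \<in> ?F \<union> ?U"
        proof (rule ccontr)
          assume not: "\<omega> \<notin> ?F \<union> ?U"
          then have "min_estimate m \<omega> \<le> H J n i \<omega>"
            using \<omega> minimum_estimate_le_min_cell[OF n, of k L I "\<lambda>i. P i \<omega>" J]
            by (auto simp: n_def k_def L_def I_def J_def i_def)
          then show False using \<omega> not by (auto simp: add_divide_distrib)
        qed
      qed
      then have "prob {\<omega> \<in> space M. g t + (C + L powr e) / (real n)\<^sup>2 < min_estimate m \<omega>} \<le> prob (?F \<union> ?U)"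
        by (rule finite_measure_mono) measurable
      also have "\<dots> \<le> prob ?F + prob ?U" by (rule measure_Un_le) measurable
      also have "\<dots> \<le> f m" unfolding f_def using F U by (simp add: L_def)
      finally show ?case by (simp add: L_def n_def)
    qed
  qed
  then show thesis using that eC by blast
qed

text \<open>
  For \<open>t = 1\<close> the extrapolation is accurate to second order. For \<open>t < 1\<close> its limit \<open>g 1\<close> is
  larger than \<open>g t\<close>.
\<close>

lemma endpoint_extrapolation_bounds:
  assumes reg: "regular_second_derivative_at l g t"
  obtains C where "0 \<le> C"
    "\<forall>\<^sub>F m in sequentially. g t - C / (real (resolution m))\<^sup>2 \<le> extrapolation (1 / real (resolution m))"
    "t = 1 \<Longrightarrow> \<forall>\<^sub>F m in sequentially. extrapolation (1 / real (resolution m)) \<le> g t + C / (real (resolution m))\<^sup>2"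
proof (cases "t = 1")
  case True
  obtain \<epsilon> C where e: "0 < \<epsilon>" and C: "\<And>h. 0 < h \<Longrightarrow> h < \<epsilon> \<Longrightarrow> \<bar>extrapolation h - g t\<bar> \<le> C * h\<^sup>2"
    using extrapolation_error[OF reg True] by blast
  have "\<forall>\<^sub>F h in at_right 0. \<bar>extrapolation h - g t\<bar> \<le> \<bar>C\<bar> * h\<^sup>2"
    unfolding eventually_at_right[OF e]
  proof (intro exI[of _ \<epsilon>] conjI allI impI)
    fix h assume "0 < h" "h < \<epsilon>"
    then have "\<bar>extrapolation h - g t\<bar> \<le> C * h\<^sup>2" by (rule C)
    also have "\<dots> \<le> \<bar>C\<bar> * h\<^sup>2" by (intro mult_right_mono) auto
    finally show "\<bar>extrapolation h - g t\<bar> \<le> \<bar>C\<bar> * h\<^sup>2" .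
  qed (rule e)
  then have *: "\<forall>\<^sub>F m in sequentially. \<bar>extrapolation (1 / real (resolution m)) - g t\<bar> \<le> \<bar>C\<bar> * (1 / real (resolution m))\<^sup>2"
    by (rule eventually_compose_filterlim) (rule filterlim_inverse_resolution)
  show thesis
  proof (rule that[of "\<bar>C\<bar>"])
    show "\<forall>\<^sub>F m in sequentially. g t - \<bar>C\<bar> / (real (resolution m))\<^sup>2 \<le> extrapolation (1 / real (resolution m))"
      using * by eventually_elim (simp add: power_divide abs_le_iff)
    show "\<forall>\<^sub>F m in sequentially. extrapolation (1 / real (resolution m)) \<le> g t + \<bar>C\<bar> / (real (resolution m))\<^sup>2"
      using * by eventually_elim (simp add: power_divide abs_le_iff)
  qed simp
next
  case False
  have "g t < g 1" using g_strict_min[of 1] False by simp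
  then have "\<forall>\<^sub>F m in sequentially. g t < extrapolation (1 / real (resolution m))"
    using order_tendstoD(1)[OF filterlim_compose[OF extrapolation_tendsto filterlim_inverse_resolution]] by simp
  then have "\<forall>\<^sub>F m in sequentially. g t - 0 / (real (resolution m))\<^sup>2 \<le> extrapolation (1 / real (resolution m))"
    by eventually_elim simp
  then show thesis using False by (intro that[of 0]) auto
qed

text \<open>
  From below, every candidate in the minimum is controlled. From above, one good candidate
  suffices: the cell of \<open>t\<close> if \<open>t < 1\<close>, and the extrapolated value at the endpoint if \<open>t = 1\<close>.
\<close>

lemma min_estimate_error_negligible:
  assumes reg: "regular_second_derivative_at l g t" and "l > 0" and "e > 0"
  obtains C where
    "(\<lambda>m. prob {\<omega> \<in> space M. (C + 2 * ln (real m) powr e) / (real (resolution m))\<^sup>2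
        < \<bar>min_estimate m \<omega> - g t\<bar>}) \<longlonglongrightarrow> 0"
proof -
  define n where "n = resolution"
  define v where "v m = ln (real m) powr e" for m :: nat
  obtain C where C: "0 \<le> C"
    and below: "\<forall>\<^sub>F m in sequentially. g t - C / (real (n m))\<^sup>2 \<le> extrapolation (1 / real (n m))"
    and above: "t = 1 \<Longrightarrow> \<forall>\<^sub>F m in sequentially. extrapolation (1 / real (n m)) \<le> g t + C / (real (n m))\<^sup>2"
    using endpoint_extrapolation_bounds[OF reg] unfolding n_def by blast
  obtain C' where C': "0 \<le> C'"
    and interior: "t < 1 \<Longrightarrow> (\<lambda>m. prob {\<omega> \<in> space M. g t + (C' + v m) / (real (n m))\<^sup>2 < min_estimate m \<omega>}) \<longlonglongrightarrow> 0"
  proof (cases "t < 1")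
    case True
    show ?thesis
      by (rule interior_upper_negligible[OF assms(1,2) True assms(3)])
         (rule that, assumption, simp add: n_def v_def)
  next
    case False
    show ?thesis by (rule that[of 0]) (use False in auto)
  qed
  define D where "D = max C C'"
  define low where "low m = {\<omega> \<in> space M. \<exists>j<n m. \<exists>i<n m. \<bar>real i - real j\<bar> \<le> ln (real m) \<and>
      leader {..<m div 2} (n m) (blocks m) j \<omega> \<and>
      H {m div 2..<m} (n m) i \<omega> \<le> g t - v m / (real (n m))\<^sup>2}" for m
  define endp where "endp m = {\<omega> \<in> space M. 2 * (v m / (real (n m))\<^sup>2) \<le>
      \<bar>endpoint_estimate {m div 2..<m} (n m) (\<lambda>i. P i \<omega>) - extrapolation (1 / real (n m))\<bar>}" for m
  define high where "high m = (if t < 1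
      then {\<omega> \<in> space M. g t + (C' + v m) / (real (n m))\<^sup>2 < min_estimate m \<omega>} else {})" for m
  have "low m \<in> sets M" for m
    unfolding low_def by measurable
  moreover have "endp m \<in> sets M" for m
    unfolding endp_def endpoint_estimate_def by measurable
  moreover have "high m \<in> sets M" for m
    unfolding high_def by (cases "t < 1") simp_all
  ultimately have sets: "low m \<in> sets M" "endp m \<in> sets M" "high m \<in> sets M" for m
    by blast+
  have "(\<lambda>m. prob (low m)) \<longlonglongrightarrow> 0"
    using leader_near_low_negligible[OF assms(3)] by (simp only: low_def n_def v_def)
  moreover have "(\<lambda>m. prob (endp m)) \<longlonglongrightarrow> 0"
    using endpoint_negligible[OF assms(3)] by (simp only: endp_def n_def v_def)
  moreover have "(\<lambda>m. prob (high m)) \<longlonglongrightarrow> 0"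
    using interior by (cases "t < 1") (simp_all add: high_def)
  ultimately have lim: "(\<lambda>m. prob (low m) + prob (endp m) + prob (high m)) \<longlonglongrightarrow> 0 + 0 + 0"
    by (intro tendsto_add)
  have above': "\<forall>\<^sub>F m in sequentially. t = 1 \<longrightarrow> extrapolation (1 / real (n m)) \<le> g t + C / (real (n m))\<^sup>2"
    using above by (cases "t = 1") auto
  have "(\<lambda>m. prob {\<omega> \<in> space M. (D + 2 * v m) / (real (n m))\<^sup>2 < \<bar>min_estimate m \<omega> - g t\<bar>}) \<longlonglongrightarrow> 0"
  proof (rule prob_tendsto_0I[OF _ lim[simplified]])
    show "\<forall>\<^sub>F m in sequentially. prob {\<omega> \<in> space M. (D + 2 * v m) / (real (n m))\<^sup>2 < \<bar>min_estimate m \<omega> - g t\<bar>}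
        \<le> prob (low m) + prob (endp m) + prob (high m)"
      using below above'
    proof eventually_elim
      case (elim m)
      define w where "w = v m / (real (n m))\<^sup>2"
      define r where "r = 1 / (real (n m))\<^sup>2"
      have w: "0 \<le> w" and r: "0 \<le> r" by (auto simp: w_def r_def v_def)
      have bounds: "C * r \<le> D * r" "C' * r \<le> D * r" "0 \<le> D * r"
        using r C by (auto simp: D_def intro!: mult_right_mono)
      have eqs: "C / (real (n m))\<^sup>2 = C * r" "(C' + v m) / (real (n m))\<^sup>2 = C' * r + w"
        "(D + 2 * v m) / (real (n m))\<^sup>2 = D * r + 2 * w"
        by (auto simp: r_def w_def add_divide_distrib)
      have "{\<omega> \<in> space M. (D + 2 * v m) / (real (n m))\<^sup>2 < \<bar>min_estimate m \<omega> - g t\<bar>}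
          \<subseteq> low m \<union> endp m \<union> high m"
      proof (rule subsetI, rule ccontr)
        fix \<omega>
        assume \<omega>: "\<omega> \<in> {\<omega> \<in> space M. (D + 2 * v m) / (real (n m))\<^sup>2 < \<bar>min_estimate m \<omega> - g t\<bar>}"
          and not: "\<omega> \<notin> low m \<union> endp m \<union> high m"
        define b where "b = endpoint_estimate {m div 2..<m} (n m) (\<lambda>i. P i \<omega>)"
        have far: "D * r + 2 * w < \<bar>min_estimate m \<omega> - g t\<bar>" and sp: "\<omega> \<in> space M"
          using \<omega> by (auto simp: eqs)
        have b: "\<bar>b - extrapolation (1 / real (n m))\<bar> < 2 * w"
          using not sp by (auto simp: endp_def b_def w_def)
        have "g t - (D * r + 2 * w) \<le> min_estimate m \<omega>"
        proof (rule ccontr)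
          assume "\<not> ?thesis"
          then have "min_estimate m \<omega> < g t - (D * r + 2 * w)" by simp
          moreover have "g t - (D * r + 2 * w) < b"
            using b elim(1) bounds unfolding eqs by linarith
          ultimately obtain j i where ji: "j < n m" "i < n m" "\<bar>real i - real j\<bar> \<le> ln (real m)"
            "(if leader {..<m div 2} (n m) (blocks m) j \<omega> then H {m div 2..<m} (n m) i \<omega> else 1)
               < g t - (D * r + 2 * w)"
            unfolding minimum_estimate_less_iff b_def n_def by auto
          then have "leader {..<m div 2} (n m) (blocks m) j \<omega>" "H {m div 2..<m} (n m) i \<omega> \<le> g t - w"
            using min_less_1 bounds w by (auto split: if_splits)
          then show False
            using not sp ji by (auto simp: low_def w_def)
        qed
        moreover have "min_estimate m \<omega> \<le> g t + (D * r + 2 * w)"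
        proof (cases "t < 1")
          case True
          then have "min_estimate m \<omega> \<le> g t + (C' * r + w)"
            using not sp by (auto simp: high_def eqs)
          then show ?thesis using bounds w by linarith
        next
          case False
          have "min_estimate m \<omega> \<le> b"
            unfolding b_def n_def by (rule minimum_estimate_le_endpoint)
          moreover have "extrapolation (1 / real (n m)) \<le> g t + C * r"
            using elim(2) False t_01 by (auto simp: eqs)
          ultimately show ?thesis using b bounds by linarith
        qed
        ultimately show False using far by (simp add: abs_le_iff)
      qed
      then have "prob {\<omega> \<in> space M. (D + 2 * v m) / (real (n m))\<^sup>2 < \<bar>min_estimate m \<omega> - g t\<bar>}
          \<le> prob (low m \<union> endp m \<union> high m)"
        by (rule finite_measure_mono) (use sets in auto)
      also have "\<dots> \<le> prob (low m) + prob (endp m) + prob (high m)"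
        using sets by (intro order_trans[OF measure_Un_le] add_right_mono measure_Un_le) auto
      finally show ?case .
    qed
  qed
  then show thesis using that unfolding n_def v_def by blast
qed

end

section \<open>Gaussian noise from comparisons within pairs\<close>

definition sign_sum :: "nat \<Rightarrow> (nat \<Rightarrow> real) \<Rightarrow> real" where
  "sign_sum q x = (\<Sum>i<q. sgn (x (2 * i) - x (2 * i + 1))) / sqrt q"

lemma abs_sign_sum_le: "\<bar>sign_sum q x\<bar> \<le> sqrt q"
proof -
  have "\<bar>\<Sum>i<q. sgn (x (2 * i) - x (2 * i + 1))\<bar> \<le> (\<Sum>i<q. 1)"
    by (intro order_trans[OF sum_abs] sum_mono) (auto simp: abs_sgn_eq)
  then have "\<bar>\<Sum>i<q. sgn (x (2 * i) - x (2 * i + 1))\<bar> / sqrt q \<le> real q / sqrt q"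
    by (intro divide_right_mono) auto
  then show ?thesis
    by (simp add: sign_sum_def abs_divide real_div_sqrt)
qed

context prob_space
begin

lemma char_distr_eq:
  assumes [measurable]: "X \<in> borel_measurable M"
  shows "char (distr M borel X) u = expectation (\<lambda>\<omega>. iexp (u * X \<omega>))"
  unfolding char_def by (subst integral_distr) auto

text \<open>
  The integrand \<open>iexp (u * x) - iexp (u * y)\<close> is bounded by \<open>|u| * |x - y|\<close> and by \<open>2\<close>.
\<close>

lemma char_diff_le:
  assumes [measurable]: "X \<in> borel_measurable M" "Y \<in> borel_measurable M" and "0 \<le> e"
  shows "norm (char (distr M borel X) u - char (distr M borel Y) u)
    \<le> \<bar>u\<bar> * e + 2 * prob {\<omega> \<in> space M. e < \<bar>X \<omega> - Y \<omega>\<bar>}"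
proof -
  let ?B = "{\<omega> \<in> space M. e < \<bar>X \<omega> - Y \<omega>\<bar>}"
  have int: "integrable M (\<lambda>\<omega>. iexp (u * Z \<omega>))" if [measurable]: "Z \<in> borel_measurable M" for Z
    by (rule integrable_const_bound[where B = 1]) (auto)
  have int_B: "integrable M (\<lambda>\<omega>. indicator ?B \<omega> :: real)"
    by (rule integrable_const_bound[where B = 1]) auto
  have "char (distr M borel X) u - char (distr M borel Y) u
      = expectation (\<lambda>\<omega>. iexp (u * X \<omega>) - iexp (u * Y \<omega>))"
    unfolding char_distr_eq[OF assms(1)] char_distr_eq[OF assms(2)]
    by (rule Bochner_Integration.integral_diff[symmetric, OF int[OF assms(1)] int[OF assms(2)]])
  also have "norm \<dots> \<le> expectation (\<lambda>\<omega>. \<bar>u\<bar> * e + 2 * indicator ?B \<omega>)"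
  proof (rule order_trans[OF integral_norm_bound integral_mono])
    show "integrable M (\<lambda>\<omega>. \<bar>u\<bar> * e + 2 * indicator ?B \<omega>)"
      using int_B by simp
    show "integrable M (\<lambda>\<omega>. norm (iexp (u * X \<omega>) - iexp (u * Y \<omega>)))"
      by (intro integrable_norm Bochner_Integration.integrable_diff int[OF assms(1)] int[OF assms(2)])
    fix \<omega> assume \<omega>: "\<omega> \<in> space M"
    have "iexp (u * X \<omega>) = iexp (u * Y \<omega>) * iexp (u * (X \<omega> - Y \<omega>))"
      unfolding exp_add[symmetric] by (simp add: algebra_simps)
    then have "norm (iexp (u * X \<omega>) - iexp (u * Y \<omega>)) = norm (iexp (u * Y \<omega>) * (iexp (u * (X \<omega> - Y \<omega>)) - 1))"
      by (simp only: right_diff_distrib mult_1_right)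
    also have "\<dots> = norm (iexp (u * (X \<omega> - Y \<omega>)) - 1)"
      by (simp add: norm_mult)
    also have "\<dots> \<le> \<bar>u\<bar> * e + 2 * indicator ?B \<omega>"
    proof (cases "\<omega> \<in> ?B")
      case True
      have "norm (iexp (u * (X \<omega> - Y \<omega>)) - 1) \<le> 1 + 1"
        by (rule order_trans[OF norm_triangle_ineq4]) simp
      then show ?thesis using True assms(3) by (simp add: add_increasing)
    next
      case False
      then have "\<bar>X \<omega> - Y \<omega>\<bar> \<le> e" using \<omega> by simp
      have "norm (iexp (u * (X \<omega> - Y \<omega>)) - 1) \<le> \<bar>u * (X \<omega> - Y \<omega>)\<bar>"
        using iexp_approx1[of "u * (X \<omega> - Y \<omega>)" 0] by simp
      also have "\<dots> \<le> \<bar>u\<bar> * e"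
        unfolding abs_mult using \<open>\<bar>X \<omega> - Y \<omega>\<bar> \<le> e\<close> by (intro mult_left_mono) auto
      finally show ?thesis using False by simp
    qed
    finally show "norm (iexp (u * X \<omega>) - iexp (u * Y \<omega>)) \<le> \<bar>u\<bar> * e + 2 * indicator ?B \<omega>" .
  qed
  also have "\<dots> = \<bar>u\<bar> * e + 2 * prob ?B"
    using int_B by (simp add: prob_space)
  finally show ?thesis .
qed

text \<open>
  A version of Slutsky's theorem, by way of characteristic functions.
\<close>

lemma weak_conv_m_perturbation:
  fixes X Y :: "nat \<Rightarrow> 'a \<Rightarrow> real"
  assumes X: "\<And>m. X m \<in> borel_measurable M" and Y: "\<And>m. Y m \<in> borel_measurable M"
    and close: "\<And>e. e > 0 \<Longrightarrow> (\<lambda>m. prob {\<omega> \<in> space M. e < \<bar>X m \<omega> - Y m \<omega>\<bar>}) \<longlonglongrightarrow> 0"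
    and N: "real_distribution N" and char_Y: "\<And>u. (\<lambda>m. char (distr M borel (Y m)) u) \<longlonglongrightarrow> char N u"
  shows "weak_conv_m (\<lambda>m. distr M borel (X m)) N"
proof (rule levy_continuity[OF _ N])
  show "real_distribution (distr M borel (X m))" for m
    using X by simp
  fix u
  have "(\<lambda>m. char (distr M borel (X m)) u - char (distr M borel (Y m)) u) \<longlonglongrightarrow> 0"
  proof (rule LIMSEQ_I)
    fix r :: real assume "r > 0"
    define e where "e = r / (2 * (\<bar>u\<bar> + 1))"
    have e: "e > 0" using \<open>r > 0\<close> by (simp add: e_def)
    have "\<bar>u\<bar> * e < r / 2"
      using \<open>r > 0\<close> by (simp add: e_def field_simps)
    have "\<forall>\<^sub>F m in sequentially. prob {\<omega> \<in> space M. e < \<bar>X m \<omega> - Y m \<omega>\<bar>} < r / 4"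
      using \<open>r > 0\<close> by (intro order_tendstoD(2)[OF close[OF e]]) simp
    then have "\<forall>\<^sub>F m in sequentially. norm (char (distr M borel (X m)) u - char (distr M borel (Y m)) u - 0) < r"
    proof eventually_elim
      case (elim m)
      show ?case
        using char_diff_le[OF X[of m] Y[of m], of e u] e elim \<open>\<bar>u\<bar> * e < r / 2\<close> by simp
    qed
    then show "\<exists>no. \<forall>m\<ge>no. norm (char (distr M borel (X m)) u - char (distr M borel (Y m)) u - 0) < r"
      by (simp add: eventually_sequentially)
  qed
  from tendsto_add[OF this char_Y[of u]]
  show "(\<lambda>m. char (distr M borel (X m)) u) \<longlonglongrightarrow> char N u" by simp
qed

end

text \<open>
  The law is the image of the standard normal law under multiplication by \<open>\<sigma>\<close>, also for \<open>\<sigma> = 0\<close>,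
  when both are the point mass at \<open>0\<close>.
\<close>

lemma normal_law_scaled_standard:
  assumes "0 \<le> \<sigma>"
  shows real_distribution_normal_law: "real_distribution (normal_law 0 (\<sigma>\<^sup>2))"
    and char_normal_law: "char (normal_law 0 (\<sigma>\<^sup>2)) u = char std_normal_distribution (\<sigma> * u)"
proof -
  interpret N: real_distribution std_normal_distribution by (rule real_dist_normal_dist)
  have eq: "normal_law 0 (\<sigma>\<^sup>2) = distr std_normal_distribution borel (\<lambda>x. \<sigma> * x)"
  proof (cases "\<sigma> = 0")
    case True
    then show ?thesis
      using N.distr_const[of 0 borel] by (simp add: normal_law_def)
  next
    case False
    have "distributed std_normal_distribution lborel (\<lambda>x. x) std_normal_density"
      by (auto simp: distributed_def distr_id2 normal_density_nonneg)
    from N.normal_density_affine[OF this, of \<sigma> 0]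
    have "distributed std_normal_distribution lborel (\<lambda>x. \<sigma> * x) (normal_density 0 \<sigma>)"
      using False assms by simp
    then have "distr std_normal_distribution lborel (\<lambda>x. \<sigma> * x) = density lborel (normal_density 0 \<sigma>)"
      by (simp add: distributed_def)
    moreover have "distr std_normal_distribution lborel (\<lambda>x. \<sigma> * x) = distr std_normal_distribution borel (\<lambda>x. \<sigma> * x)"
      by (rule distr_cong) auto
    ultimately show ?thesis
      using False assms by (simp add: normal_law_def)
  qed
  show "real_distribution (normal_law 0 (\<sigma>\<^sup>2))" unfolding eq by simp
  show "char (normal_law 0 (\<sigma>\<^sup>2)) u = char std_normal_distribution (\<sigma> * u)"
    unfolding eq by (subst N.char_distr_eq) (auto simp: char_def mult_ac)
qed

context iid_sample
begin

lemma cdf_P_eq: "cdf (distr M borel (P i)) s = G (max 0 (min 1 s))"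
proof -
  interpret D: real_distribution "distr M borel (P i)" by simp
  consider "s < 0" | "s \<in> {0..1}" | "1 < s" by fastforce
  then show ?thesis
  proof cases
    case 1
    then show ?thesis
      using D.cdf_nondecreasing[of s 0] D.cdf_nonneg[of s] by (simp add: cdf_P G_0)
  next
    case 2
    then show ?thesis by (simp add: cdf_P)
  next
    case 3
    then show ?thesis
      using D.cdf_nondecreasing[of 1 s] D.cdf_bounded_prob[of s] by (simp add: cdf_P G_1)
  qed
qed

lemma distr_P_eq: "distr M borel (P i) = distr M borel (P j)"
  by (rule cdf_unique) (auto simp: cdf_P_eq fun_eq_iff)

text \<open>
  There are no atoms, so that ties within a pair of observations have probability \<open>0\<close>.
\<close>

lemma measure_P_singleton: "measure (distr M borel (P i)) {x} = 0"
proof -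
  interpret D: real_distribution "distr M borel (P i)" by simp
  have "continuous_on UNIV (\<lambda>s. G (max 0 (min 1 s)))"
    by (intro continuous_on_compose2[OF G_continuous] continuous_intros) auto
  then have "isCont (cdf (distr M borel (P i))) x"
    by (simp add: cdf_P_eq[abs_def] continuous_on_eq_continuous_at)
  then show ?thesis by (simp add: D.isCont_cdf)
qed

abbreviation comparison :: "nat \<Rightarrow> 'w \<Rightarrow> real" where
  "comparison i \<omega> \<equiv> sgn (P (2 * i) \<omega> - P (2 * i + 1) \<omega>)"

lemma indep_comparison: "indep_vars (\<lambda>_. borel) comparison UNIV"
proof -
  let ?K = "\<lambda>i. {2 * i, 2 * i + 1} :: nat set"
  have "disjoint_family_on ?K UNIV"
    unfolding disjoint_family_on_def by (auto; presburger)
  then have "indep_vars (\<lambda>i. PiM (?K i) (\<lambda>_. borel)) (\<lambda>i \<omega>. restrict (\<lambda>j. P j \<omega>) (?K i)) UNIV"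
    by (intro indep_vars_restrict[OF indep]) auto
  then have "indep_vars (\<lambda>_. borel)
      (\<lambda>i \<omega>. (\<lambda>x. sgn (x (2 * i) - x (2 * i + 1)) :: real) (restrict (\<lambda>j. P j \<omega>) (?K i))) UNIV"
  proof (rule indep_vars_compose2)
    fix i
    have "(\<lambda>x. x (2 * i)) \<in> borel_measurable (PiM (?K i) (\<lambda>_. borel))"
      "(\<lambda>x. x (2 * i + 1)) \<in> borel_measurable (PiM (?K i) (\<lambda>_. borel))"
      by (auto intro!: measurable_component_singleton)
    then show "(\<lambda>x. sgn (x (2 * i) - x (2 * i + 1)) :: real) \<in> borel_measurable (PiM (?K i) (\<lambda>_. borel))"
      by (intro measurable_compose[OF _ borel_measurable_sgn] borel_measurable_diff)
  qed
  then show ?thesis by simp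
qed

lemma distr_pair:
  assumes "i \<noteq> j"
  shows "distr M (borel \<Otimes>\<^sub>M borel) (\<lambda>\<omega>. (P i \<omega>, P j \<omega>))
    = distr M borel (P 0) \<Otimes>\<^sub>M distr M borel (P 0)"
proof -
  have "indep_var borel ((\<lambda>f. f i) \<circ> (\<lambda>\<omega>. restrict (\<lambda>i. P i \<omega>) {i}))
    borel ((\<lambda>f. f j) \<circ> (\<lambda>\<omega>. restrict (\<lambda>i. P i \<omega>) {j}))"
    using assms by (intro indep_var_compose[OF indep_var_restrict[OF indep]]) auto
  then have "indep_var borel (P i) borel (P j)"
    by (simp add: comp_def)
  then show ?thesis
    using distr_P_eq[of i 0] distr_P_eq[of j 0] by (simp add: indep_var_distribution_eq)
qed

lemma distr_comparison:
  "distr M borel (comparison i)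
    = distr (distr M borel (P 0) \<Otimes>\<^sub>M distr M borel (P 0)) borel (\<lambda>p. sgn (fst p - snd p))"
proof -
  have "distr M borel (comparison i)
      = distr (distr M (borel \<Otimes>\<^sub>M borel) (\<lambda>\<omega>. (P (2 * i) \<omega>, P (2 * i + 1) \<omega>))) borel (\<lambda>p. sgn (fst p - snd p))"
    by (subst distr_distr) (auto simp: comp_def)
  then show ?thesis by (subst (asm) distr_pair) auto
qed

text \<open>
  Exchanging the two observations preserves their joint law and changes the sign.
\<close>

lemma expectation_comparison: "expectation (comparison i) = 0"
proof -
  let ?\<nu> = "distr M borel (P 0)"
  interpret \<nu>: prob_space ?\<nu> by (rule prob_space_distr) simp
  interpret pair: pair_sigma_finite ?\<nu> ?\<nu> ..
  let ?E = "integral\<^sup>L (?\<nu> \<Otimes>\<^sub>M ?\<nu>) (\<lambda>p. sgn (fst p - snd p))"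
  have "expectation (comparison i) = integral\<^sup>L (distr M borel (comparison i)) (\<lambda>x. x)"
    by (subst integral_distr) auto
  also have "\<dots> = ?E"
    unfolding distr_comparison by (subst integral_distr) auto
  also have "?E = - ?E"
  proof -
    have "?E = (\<integral>(x, y). sgn (fst (y, x) - snd (y, x)) \<partial>(?\<nu> \<Otimes>\<^sub>M ?\<nu>))"
      by (rule pair.integral_product_swap[symmetric]) measurable
    also have "\<dots> = (\<integral>p. - sgn (fst p - snd p) \<partial>(?\<nu> \<Otimes>\<^sub>M ?\<nu>))"
      by (intro Bochner_Integration.integral_cong) (auto simp: sgn_minus[symmetric])
    finally show ?thesis by simp
  qed
  then have "?E = 0" by simp
  finally show ?thesis .
qed

lemma expectation_comparison_square: "expectation (\<lambda>\<omega>. (comparison i \<omega>)\<^sup>2) = 1"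
proof -
  let ?\<nu> = "distr M borel (P 0)"
  interpret \<nu>: prob_space ?\<nu> by (rule prob_space_distr) simp
  interpret pair: pair_prob_space ?\<nu> ?\<nu> ..
  let ?D = "{p \<in> space (?\<nu> \<Otimes>\<^sub>M ?\<nu>). fst p = snd p}"
  have D: "?D \<in> sets (?\<nu> \<Otimes>\<^sub>M ?\<nu>)" by measurable
  have "emeasure (?\<nu> \<Otimes>\<^sub>M ?\<nu>) ?D = (\<integral>\<^sup>+x. emeasure ?\<nu> (Pair x -` ?D) \<partial>?\<nu>)"
    by (rule \<nu>.emeasure_pair_measure_alt[OF D])
  also have "\<dots> = (\<integral>\<^sup>+x. 0 \<partial>?\<nu>)"
  proof (rule nn_integral_cong)
    fix x
    have "Pair x -` ?D = {x}" by (auto simp: space_pair_measure)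
    then show "emeasure ?\<nu> (Pair x -` ?D) = 0"
      using measure_P_singleton[of 0 x] by (simp add: \<nu>.emeasure_eq_measure)
  qed
  finally have "AE p in ?\<nu> \<Otimes>\<^sub>M ?\<nu>. fst p \<noteq> snd p"
    using D by (intro AE_I[where N = ?D]) auto
  then have AE: "AE p in ?\<nu> \<Otimes>\<^sub>M ?\<nu>. (sgn (fst p - snd p))\<^sup>2 = (1 :: real)"
    by eventually_elim (auto simp: sgn_real_def)
  have "expectation (\<lambda>\<omega>. (comparison i \<omega>)\<^sup>2) = integral\<^sup>L (distr M borel (comparison i)) (\<lambda>x. x\<^sup>2)"
    by (subst integral_distr) auto
  also have "\<dots> = integral\<^sup>L (?\<nu> \<Otimes>\<^sub>M ?\<nu>) (\<lambda>p. (sgn (fst p - snd p))\<^sup>2)"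
    unfolding distr_comparison by (subst integral_distr) auto
  also have "\<dots> = integral\<^sup>L (?\<nu> \<Otimes>\<^sub>M ?\<nu>) (\<lambda>p. 1)"
    by (rule integral_cong_AE) (use AE in auto)
  also have "\<dots> = 1"
    unfolding lebesgue_integral_const pair.P.prob_space by simp
  finally show ?thesis .
qed

lemma sign_sum_weak_conv:
  "weak_conv_m (\<lambda>q. distr M borel (\<lambda>\<omega>. sign_sum q (\<lambda>i. P i \<omega>))) std_normal_distribution"
proof -
  have "weak_conv_m (\<lambda>q. distr M borel (\<lambda>\<omega>. (\<Sum>i<q. comparison i \<omega>) / sqrt (real q * 1\<^sup>2))) std_normal_distribution"
  proof (rule central_limit_theorem_zero_mean[where \<mu> = "distr M borel (comparison 0)"])
    show "integrable M (\<lambda>\<omega>. (comparison i \<omega>)\<^sup>2)" for i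
      by (rule integrable_const_bound[where B = 1]) (auto simp: sgn_real_def)
    show "variance (comparison i) = 1\<^sup>2" for i
      unfolding expectation_comparison using expectation_comparison_square[of i] by simp
    show "distr M borel (comparison i) = distr M borel (comparison 0)" for i
      by (simp only: distr_comparison)
  qed (rule indep_comparison expectation_comparison zero_less_one)+
  then show ?thesis by (simp add: sign_sum_def)
qed

lemma measurable_sign_sum [measurable]: "(\<lambda>\<omega>. sign_sum q (\<lambda>i. P i \<omega>)) \<in> borel_measurable M"
  unfolding sign_sum_def by measurable

end

section \<open>The estimator and its limit law\<close>

definition scaling :: "real \<Rightarrow> nat \<Rightarrow> real" where
  "scaling \<delta> m = real m powr (2/5) / ln (real m) powr \<delta>"

text \<open>
  Few pairs are used in order that the noise, which is at most \<open>sqrt (pairs m)\<close>, stays below the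
  scaling factor.
\<close>

definition pairs :: "nat \<Rightarrow> nat" where "pairs m = nat \<lfloor>ln (real m)\<rfloor>"

text \<open>
  \<open>1 - u\<close> estimates the target with an error that the scaling does not see; the last summand is
  approximately Gaussian noise of standard deviation \<open>u / scaling \<delta> m\<close>, where \<open>u\<close> tends to
  \<open>g t = 1 - lower_a a F\<close>.
\<close>

definition estimator :: "real \<Rightarrow> nat \<Rightarrow> (nat \<Rightarrow> real) \<Rightarrow> real" where
  "estimator \<delta> m x =
     (let u = minimum_estimate {..<m div 2} {m div 2..<m} (resolution m) (blocks m) (ln (real m)) x
      in 1 - u + u * sign_sum (pairs m) x / scaling \<delta> m)"

lemma twice_pairs_le: "2 * pairs m \<le> m"
proof (cases "m = 0")
  case False
  have "ln (real m / 2) \<le> real m / 2 - 1"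
    using False by (intro ln_le_minus_one) simp
  moreover have "ln (2::real) \<le> 2 - 1" by (rule ln_le_minus_one) simp
  ultimately have "2 * ln (real m) \<le> real m"
    using False by (simp add: ln_div)
  moreover have "real (pairs m) \<le> ln (real m)"
    using False by (simp add: pairs_def)
  ultimately have "real (2 * pairs m) \<le> real m" by simp
  then show ?thesis by linarith
qed (simp add: pairs_def)

lemma filterlim_pairs: "filterlim pairs at_top sequentially"
  unfolding pairs_def
  by (intro filterlim_compose[OF filterlim_nat_sequentially filterlim_compose[OF filterlim_floor_sequentially filterlim_ln_sequentially]])

lemma estimator_sequence_estimator: "estimator_sequence (estimator \<delta>)"
  unfolding estimator_sequence_def
proof
  fix m :: nat
  let ?N = "Pi\<^sub>M {..<m} (\<lambda>_. borel :: real measure)"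
  have "minimum_estimate {..<m div 2} {m div 2..<m} (resolution m) (blocks m) (ln (real m)) \<in> borel_measurable ?N"
    by (rule measurable_minimum_estimate) auto
  moreover have "sign_sum (pairs m) \<in> borel_measurable ?N"
  proof -
    have "(\<lambda>x. sgn (x (2 * i) - x (2 * i + 1))) \<in> borel_measurable ?N" if "i < pairs m" for i
      using that twice_pairs_le[of m]
      by (intro measurable_compose[OF _ borel_measurable_sgn] borel_measurable_diff measurable_component_singleton) auto
    then have "(\<lambda>x. (\<Sum>i<pairs m. sgn (x (2 * i) - x (2 * i + 1))) / sqrt (pairs m)) \<in> borel_measurable ?N"
      by (intro borel_measurable_divide borel_measurable_sum borel_measurable_const) auto
    then show ?thesis unfolding sign_sum_def[abs_def] .
  qed
  ultimately show "estimator \<delta> m \<in> borel_measurable ?N"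
    unfolding estimator_def[abs_def] Let_def
    by (intro borel_measurable_add borel_measurable_diff borel_measurable_times borel_measurable_divide borel_measurable_const)
qed

lemma estimator_cong:
  assumes "\<And>i. i < m \<Longrightarrow> x i = y i"
  shows "estimator \<delta> m x = estimator \<delta> m y"
proof -
  have "sign_sum (pairs m) x = sign_sum (pairs m) y"
    unfolding sign_sum_def using twice_pairs_le[of m] assms by (auto intro!: sum.cong arg_cong2[where f = "(/)"])
  moreover have "minimum_estimate {..<m div 2} {m div 2..<m} n k L x = minimum_estimate {..<m div 2} {m div 2..<m} n k L y" for n k L
    using assms by (intro minimum_estimate_cong) auto
  ultimately show ?thesis by (simp add: estimator_def)
qed

context iid_sample
begin

text \<open>
  The error of \<open>u\<close> is of order \<open>(ln m)^(\<delta>/2) * m^(-2/5)\<close>, which leaves a factor \<open>(ln m)^(-\<delta>/2)\<close>.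
\<close>

lemma scaled_error_negligible:
  assumes reg: "regular_second_derivative_at l g t" and "l > 0" and "\<delta> > 0" and "e > 0"
  shows "(\<lambda>m. prob {\<omega> \<in> space M. e < scaling \<delta> m * \<bar>min_estimate m \<omega> - g t\<bar>}) \<longlonglongrightarrow> 0"
proof -
  obtain C where C: "(\<lambda>m. prob {\<omega> \<in> space M. (C + 2 * ln (real m) powr (\<delta> / 2)) / (real (resolution m))\<^sup>2
        < \<bar>min_estimate m \<omega> - g t\<bar>}) \<longlonglongrightarrow> 0"
    using min_estimate_error_negligible[OF assms(1,2), of "\<delta> / 2"] \<open>\<delta> > 0\<close> by auto
  have lim: "(\<lambda>m. (\<bar>C\<bar> + 2 * ln (real m) powr (\<delta> / 2)) / ln (real m) powr \<delta>) \<longlonglongrightarrow> 0"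
  proof -
    have "((\<lambda>x. (\<bar>C\<bar> + 2 * x powr (\<delta> / 2)) / x powr \<delta>) \<longlongrightarrow> 0) at_top"
    proof -
      have "((\<lambda>x. \<bar>C\<bar> * (1 / x powr \<delta>) + 2 * (x powr (\<delta> / 2) / x powr \<delta>)) \<longlongrightarrow> \<bar>C\<bar> * 0 + 2 * 0) at_top"
        using \<open>\<delta> > 0\<close> by (intro tendsto_add tendsto_mult_left) real_asymp+
      then show ?thesis by (simp add: add_divide_distrib)
    qed
    then show ?thesis by (rule filterlim_compose) (rule filterlim_ln_sequentially)
  qed
  show ?thesis
  proof (rule prob_tendsto_0I[OF _ C])
    show "\<forall>\<^sub>F m in sequentially. prob {\<omega> \<in> space M. e < scaling \<delta> m * \<bar>min_estimate m \<omega> - g t\<bar>}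
        \<le> prob {\<omega> \<in> space M. (C + 2 * ln (real m) powr (\<delta> / 2)) / (real (resolution m))\<^sup>2 < \<bar>min_estimate m \<omega> - g t\<bar>}"
      using order_tendstoD(2)[OF lim \<open>e > 0\<close>] eventually_ge_at_top[of 3]
    proof eventually_elim
      case (elim m)
      let ?L = "ln (real m)" and ?n = "real (resolution m)"
      have L: "0 < ?L" using elim by simp
      then have s: "0 < scaling \<delta> m" using elim by (simp add: scaling_def)
      have n: "real m powr (2/5) \<le> ?n\<^sup>2" by (rule square_resolution_ge)
      have "0 < real m powr (2/5)" using elim by simp
      then have n0: "0 < ?n\<^sup>2" using n by (rule less_le_trans)
      have "scaling \<delta> m * ((C + 2 * ?L powr (\<delta> / 2)) / ?n\<^sup>2)
          \<le> scaling \<delta> m * ((\<bar>C\<bar> + 2 * ?L powr (\<delta> / 2)) / ?n\<^sup>2)"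
        using s by (intro mult_left_mono divide_right_mono) auto
      also have "\<dots> = (real m powr (2/5) / ?n\<^sup>2) * ((\<bar>C\<bar> + 2 * ?L powr (\<delta> / 2)) / ?L powr \<delta>)"
        by (simp add: scaling_def)
      also have "\<dots> \<le> 1 * ((\<bar>C\<bar> + 2 * ?L powr (\<delta> / 2)) / ?L powr \<delta>)"
        using n n0 by (intro mult_right_mono) auto
      also have "\<dots> < e" using elim by simp
      finally have bound: "scaling \<delta> m * ((C + 2 * ?L powr (\<delta> / 2)) / ?n\<^sup>2) < e" .
      show ?case
      proof (rule finite_measure_mono)
        show "{\<omega> \<in> space M. e < scaling \<delta> m * \<bar>min_estimate m \<omega> - g t\<bar>}
          \<subseteq> {\<omega> \<in> space M. (C + 2 * ?L powr (\<delta> / 2)) / ?n\<^sup>2 < \<bar>min_estimate m \<omega> - g t\<bar>}"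
        proof clarify
          fix \<omega> assume "e < scaling \<delta> m * \<bar>min_estimate m \<omega> - g t\<bar>"
          with bound have "scaling \<delta> m * ((C + 2 * ?L powr (\<delta> / 2)) / ?n\<^sup>2) < scaling \<delta> m * \<bar>min_estimate m \<omega> - g t\<bar>"
            by (rule less_trans)
          then show "(C + 2 * ?L powr (\<delta> / 2)) / ?n\<^sup>2 < \<bar>min_estimate m \<omega> - g t\<bar>"
            using s by (simp only: mult_less_cancel_left_pos)
        qed
      qed measurable
    qed
  qed
qed

text \<open>
  The scaled error is \<open>g t * Z\<close> up to \<open>(g t - u) * (r - Z)\<close>, and \<open>|r - Z| \<le> 2 * r\<close> surely.
\<close>

lemma estimator_weak_conv:
  assumes reg: "regular_second_derivative_at l g t" and "l > 0" and "\<delta> > 0"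
  shows "weak_conv_m (\<lambda>m. distr M borel (\<lambda>\<omega>. scaling \<delta> m * (estimate (estimator \<delta>) P m \<omega> - lower_a a F)))
     (normal_law 0 ((1 - lower_a a F)\<^sup>2))"
proof -
  let ?Z = "\<lambda>m \<omega>. sign_sum (pairs m) (\<lambda>i. P i \<omega>)"
  let ?X = "\<lambda>m \<omega>. scaling \<delta> m * (estimator \<delta> m (\<lambda>i. P i \<omega>) - (1 - g t))"
  have estimate_eq: "estimate (estimator \<delta>) P m \<omega> = estimator \<delta> m (\<lambda>i. P i \<omega>)" for m \<omega>
    unfolding estimate_def by (rule estimator_cong) simp
  have meas: "?X m \<in> borel_measurable M" for m
    unfolding estimator_def Let_def by measurable
  have sqrt_le: "\<forall>\<^sub>F m in sequentially. sqrt (pairs m) \<le> scaling \<delta> m"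
  proof -
    have "\<forall>\<^sub>F m in sequentially. sqrt (ln (real m)) \<le> scaling \<delta> m"
      unfolding scaling_def by real_asymp
    then show ?thesis
      using eventually_ge_at_top[of 3]
    proof eventually_elim
      case (elim m)
      have "sqrt (pairs m) \<le> sqrt (ln (real m))" using elim by (simp add: pairs_def)
      from this elim(1) show ?case by (rule order_trans)
    qed
  qed
  have "weak_conv_m (\<lambda>m. distr M borel (?X m)) (normal_law 0 ((g t)\<^sup>2))"
  proof (rule weak_conv_m_perturbation[where Y = "\<lambda>m \<omega>. g t * ?Z m \<omega>"])
    show "real_distribution (normal_law 0 ((g t)\<^sup>2))"
      by (rule real_distribution_normal_law[OF min_nonneg])
    show "(\<lambda>m. char (distr M borel (\<lambda>\<omega>. g t * ?Z m \<omega>)) u) \<longlonglongrightarrow> char (normal_law 0 ((g t)\<^sup>2)) u" for u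
    proof -
      have "(\<lambda>q. char (distr M borel (\<lambda>\<omega>. sign_sum q (\<lambda>i. P i \<omega>))) (g t * u)) \<longlonglongrightarrow> char std_normal_distribution (g t * u)"
        by (rule levy_continuity1[OF _ real_dist_normal_dist sign_sum_weak_conv]) simp
      from filterlim_compose[OF this filterlim_pairs]
      show ?thesis
        by (simp add: char_normal_law[OF min_nonneg] char_distr_eq mult_ac)
    qed
    fix e :: real assume "e > 0"
    then have lim: "(\<lambda>m. prob {\<omega> \<in> space M. e / 2 < scaling \<delta> m * \<bar>min_estimate m \<omega> - g t\<bar>}) \<longlonglongrightarrow> 0"
      by (intro scaled_error_negligible[OF assms]) simp
    show "(\<lambda>m. prob {\<omega> \<in> space M. e < \<bar>?X m \<omega> - g t * ?Z m \<omega>\<bar>}) \<longlonglongrightarrow> 0"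
    proof (rule prob_tendsto_0I[OF _ lim])
      show "\<forall>\<^sub>F m in sequentially. prob {\<omega> \<in> space M. e < \<bar>?X m \<omega> - g t * ?Z m \<omega>\<bar>}
          \<le> prob {\<omega> \<in> space M. e / 2 < scaling \<delta> m * \<bar>min_estimate m \<omega> - g t\<bar>}"
        using sqrt_le eventually_ge_at_top[of 3]
      proof eventually_elim
        case (elim m)
        let ?r = "scaling \<delta> m"
        have "0 < ln (real m)" using elim by simp
        then have r: "0 < ?r" using elim by (simp add: scaling_def)
        have "\<bar>?X m \<omega> - g t * ?Z m \<omega>\<bar> \<le> 2 * (?r * \<bar>min_estimate m \<omega> - g t\<bar>)" for \<omega>
        proof -
          have "?X m \<omega> - g t * ?Z m \<omega> = (g t - min_estimate m \<omega>) * (?r - ?Z m \<omega>)"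
            using r by (simp add: estimator_def Let_def field_simps)
          moreover have "\<bar>?r - ?Z m \<omega>\<bar> \<le> 2 * ?r"
            using abs_sign_sum_le[of "pairs m" "\<lambda>i. P i \<omega>"] elim(1) by linarith
          then have "\<bar>g t - min_estimate m \<omega>\<bar> * \<bar>?r - ?Z m \<omega>\<bar> \<le> \<bar>g t - min_estimate m \<omega>\<bar> * (2 * ?r)"
            by (intro mult_left_mono) auto
          ultimately show ?thesis
            by (simp add: abs_mult abs_minus_commute mult_ac)
        qed
        then have "{\<omega> \<in> space M. e < \<bar>?X m \<omega> - g t * ?Z m \<omega>\<bar>}
            \<subseteq> {\<omega> \<in> space M. e / 2 < ?r * \<bar>min_estimate m \<omega> - g t\<bar>}"
          by (smt (verit) Collect_mono_iff field_sum_of_halves)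
        then show ?case by (rule finite_measure_mono) measurable
      qed
    qed
  qed (use meas in auto)
  then show ?thesis
    by (simp add: estimate_eq lower_a_eq)
qed

end

theorem theorem3p2:
  fixes \<delta> :: real
  assumes "\<delta> > 0"
  shows "\<exists>T. estimator_sequence T \<and>
    (\<forall>(M :: 'w measure) (P :: nat \<Rightarrow> 'w \<Rightarrow> real) (a :: real) (F :: real \<Rightarrow> real)
       (g :: real \<Rightarrow> real) (t :: real) (l :: real).
       iid_mixture_model M P a F \<longrightarrow>
       derivative_density (uniform_mixture a F) g \<longrightarrow>
       unique_minimiser g t \<longrightarrow>
       l > 0 \<longrightarrow>
       regular_second_derivative_at l g t \<longrightarrow>
       weak_conv_m
         (\<lambda>m. distr M borel (\<lambda>\<omega>. real m powr (2/5) / ln (real m) powr \<delta>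
                                 * (estimate T P m \<omega> - lower_a a F)))
         (normal_law 0 ((1 - lower_a a F)\<^sup>2)))"
proof (intro exI[of _ "estimator \<delta>"] conjI allI impI)
  show "estimator_sequence (estimator \<delta>)"
    by (rule estimator_sequence_estimator)
  fix M :: "'w measure" and P a F g t l
  assume model: "iid_mixture_model M P a F" and density: "derivative_density (uniform_mixture a F) g"
    and minimiser: "unique_minimiser g t" and l: "l > 0" and reg: "regular_second_derivative_at l g t"
  interpret prob_space M
    using model unfolding iid_mixture_model_def by blast
  interpret mixture_density a F g t
    using model density minimiser unfolding iid_mixture_model_def mixture_density_def by blast
  interpret iid_sample M P a F g t
  proof
    show "indep_vars (\<lambda>_. borel) P UNIV"
      using model unfolding iid_mixture_model_def by blast
    show "cdf (distr M borel (P i)) s = uniform_mixture a F s" if "s \<in> {0..1}" for i s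
      using model that unfolding iid_mixture_model_def by blast
  qed
  show "weak_conv_m
         (\<lambda>m. distr M borel (\<lambda>\<omega>. real m powr (2/5) / ln (real m) powr \<delta>
                                 * (estimate (estimator \<delta>) P m \<omega> - lower_a a F)))
         (normal_law 0 ((1 - lower_a a F)\<^sup>2))"
    using estimator_weak_conv[OF reg l assms] unfolding scaling_def .
qed

end
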